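(* Let $n\ge1$, $\beta>0$ and let $\gamma=(\gamma_1,\dots,\gamma_n)$ be a multi-index with $\gamma_i\ge0$. Let $u_0\in L^1(\mathbb{R}^n)$ and assume that $I_\beta u_0\in L^1(\mathbb{R}^n)$. Denote $$A=\lim_{|\xi|\to0}\frac{\widehat u_0(\xi)}{|\xi|^\beta}=\int_{\mathbb{R}^n}(I_\beta u_0)(x)\,dx.$$ Then $$\|\partial^\gamma e^{t\Delta}u_0\|_1\le C\,t^{-\beta/2-|\gamma|/2}\,\|I_\beta u_0\|_1$$ for all $t>0$, with a constant $C=C(\beta,\gamma)$ independent of $t$ and $u_0$ (it may depend on the dimension $n$); moreover, $$t^{\beta/2+|\gamma|/2}\,\|\partial^\gamma e^{t\Delta}u_0-A\,\partial^\gamma D^\beta G(\cdot,t)\|_1\to0\quad\text{as }t\to\infty.$$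
   Context: $\|\cdot\|_1$ is the norm of $L^1(\mathbb{R}^n)$. $G(x,t)=(4\pi t)^{-n/2}\exp(-|x|^2/(4t))$ and $e^{t\Delta}u_0=G(\cdot,t)*u_0$. Fourier transform: $\widehat v(\xi)=\int_{\mathbb{R}^n}e^{-ix\cdot\xi}v(x)\,dx$, so $\widehat{G(\cdot,t)}(\xi)=e^{-t|\xi|^2}$. The Riesz potential and fractional derivative are defined by $\widehat{I_\beta w}(\xi)=\widehat w(\xi)/|\xi|^\beta$ and $\widehat{D^\beta w}(\xi)=|\xi|^\beta\widehat w(\xi)$; "$I_\beta u_0\in L^1$" means that there is a function in $L^1(\mathbb{R}^n)$, denoted $I_\beta u_0$, whose Fourier transform equals $\widehat u_0(\xi)/|\xi|^\beta$ for $\xi\ne0$. $\partial^\gamma=\partial^{|\gamma|}/\partial x_1^{\gamma_1}\cdots\partial x_n^{\gamma_n}$, $|\gamma|=\gamma_1+\dots+\gamma_n$. *)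

theory Defs
  imports "HOL-Analysis.Analysis"
begin

definition l1_norm :: "(real ^ 'n \<Rightarrow> complex) \<Rightarrow> real" where
  "l1_norm f = (LINT x|lebesgue. norm (f x))"

definition fourier_transform :: "(real ^ 'n \<Rightarrow> complex) \<Rightarrow> real ^ 'n \<Rightarrow> complex" where
  "fourier_transform f \<xi> = (LINT x|lebesgue. exp (- \<i> * complex_of_real (x \<bullet> \<xi>)) * f x)"

definition heat_kernel :: "real \<Rightarrow> real ^ 'n \<Rightarrow> complex" where
  "heat_kernel t x =
     complex_of_real ((4 * pi * t) powr (- real CARD('n) / 2) * exp (- (norm x)\<^sup>2 / (4 * t)))"

definition heat_semigroup :: "real \<Rightarrow> (real ^ 'n \<Rightarrow> complex) \<Rightarrow> real ^ 'n \<Rightarrow> complex" where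
  "heat_semigroup t f x = (LINT y|lebesgue. heat_kernel t (x - y) * f y)"

text \<open>\<open>is_riesz_potential \<beta> w v\<close> says that \<open>I\<^sub>\<beta> w\<close> is in \<open>L\<^sup>1\<close> and is represented by \<open>v\<close>;
  \<open>v\<close> is determined by \<open>w\<close> up to a null set.\<close>

definition is_riesz_potential ::
    "real \<Rightarrow> (real ^ 'n \<Rightarrow> complex) \<Rightarrow> (real ^ 'n \<Rightarrow> complex) \<Rightarrow> bool" where
  "is_riesz_potential \<beta> w v \<longleftrightarrow>
     integrable lebesgue v \<and>
     (\<forall>\<xi>. \<xi> \<noteq> 0 \<longrightarrow>
        fourier_transform v \<xi> = fourier_transform w \<xi> / complex_of_real (norm \<xi> powr \<beta>))"

definition is_frac_deriv ::
    "real \<Rightarrow> (real ^ 'n \<Rightarrow> complex) \<Rightarrow> (real ^ 'n \<Rightarrow> complex) \<Rightarrow> bool" where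
  "is_frac_deriv \<beta> w v \<longleftrightarrow>
     integrable lebesgue v \<and>
     (\<forall>\<xi>. fourier_transform v \<xi> = complex_of_real (norm \<xi> powr \<beta>) * fourier_transform w \<xi>)"

text \<open>An integrable function is determined by its Fourier transform only almost everywhere. Taking the
  continuous representative makes it unique, so that pointwise derivatives of \<open>D\<^sup>\<beta> w\<close> make sense.\<close>

definition frac_deriv :: "real \<Rightarrow> (real ^ 'n \<Rightarrow> complex) \<Rightarrow> real ^ 'n \<Rightarrow> complex" where
  "frac_deriv \<beta> w = (THE v. continuous_on UNIV v \<and> is_frac_deriv \<beta> w v)"

definition partial_deriv :: "'n \<Rightarrow> (real ^ 'n \<Rightarrow> complex) \<Rightarrow> real ^ 'n \<Rightarrow> complex" where
  "partial_deriv i f x = vector_derivative (\<lambda>s. f (x + s *\<^sub>R axis i 1)) (at 0)"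

text \<open>The linear order on the index type fixes the order in which the partial derivatives are taken;
  it is irrelevant for smooth functions.\<close>

definition multi_deriv ::
    "nat ^ 'n::{finite,linorder} \<Rightarrow> (real ^ 'n::{finite,linorder} \<Rightarrow> complex) \<Rightarrow> real ^ 'n::{finite,linorder} \<Rightarrow> complex" where
  "multi_deriv \<gamma> f = foldr (\<lambda>i. partial_deriv i ^^ (\<gamma> $ i)) (sorted_list_of_set UNIV) f"

definition multi_order :: "nat ^ 'n \<Rightarrow> nat" where
  "multi_order \<gamma> = (\<Sum>i\<in>UNIV. \<gamma> $ i)"

end

theory Submission
  imports Defs "HOL-Probability.Characteristic_Functions" "HOL-Real_Asymp.Real_Asymp"
begin

text \<open>
  Write \<open>G\<^sub>t\<close> for the heat kernel. The point is that \<open>|\<xi>|\<^sup>\<beta> e\<^sup>-\<^sup>t\<^sup>|\<^sup>\<xi>\<^sup>|\<^sup>2\<close> is the Fourier transform of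
  an \<open>L\<^sup>1\<close> function \<open>K\<^sub>t\<close>. For \<open>0 < \<beta> < 2\<close> one takes a multiple of the integral of
  \<open>(G\<^sub>t - G\<^sub>t\<^sub>+\<^sub>s) s\<^sup>-\<^sup>1\<^sup>-\<^sup>\<beta>\<^sup>/\<^sup>2\<close> over \<open>s > 0\<close>, which converges in \<open>L\<^sup>1\<close> because
  the norm of \<open>G\<^sub>t - G\<^sub>t\<^sub>+\<^sub>s\<close> is at most \<open>min 2 (n s / t)\<close>; larger \<open>\<beta>\<close> are reached by convolving such
  kernels. By uniqueness of the Fourier transform of continuous integrable functions,
  \<open>e\<^sup>t\<^sup>\<Delta>u\<^sub>0 = G\<^sub>\<tau> * (K\<^sub>\<tau> * I\<^sub>\<beta>u\<^sub>0)\<close> and \<open>D\<^sup>\<beta>G\<^sub>t = G\<^sub>\<tau> * K\<^sub>\<tau>\<close> with \<open>\<tau> = t/2\<close>. All derivatives fall on the first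
  factor, so Young's inequality and scaling give the bound, and the asymptotics reduce to
  \<open>\<parallel>K\<^sub>\<tau> * v - (\<integral>v) K\<^sub>\<tau>\<parallel>\<^sub>1 = o(\<tau>\<^sup>-\<^sup>\<beta>\<^sup>/\<^sup>2)\<close>, which is continuity of translations in \<open>L\<^sup>1\<close> together with
  dominated convergence.
\<close>

section \<open>Convolution and Fourier transform\<close>

lemma lborel_integrable_affine:
  fixes f :: "'a::euclidean_space \<Rightarrow> 'b::{banach, second_countable_topology}"
  assumes f: "integrable lborel f" and c: "c \<noteq> 0"
  shows "integrable lborel (\<lambda>x. f (t + c *\<^sub>R x))"
proof -
  have [measurable]: "f \<in> borel_measurable borel"
    using borel_measurable_integrable[OF f] by simp
  have "(\<integral>\<^sup>+x. norm (f x) \<partial>lborel) = ennreal (\<bar>c\<bar>^DIM('a)) * (\<integral>\<^sup>+x. norm (f (t + c *\<^sub>R x)) \<partial>lborel)"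
    by (subst lborel_affine[OF c, of t]) (simp add: nn_integral_density nn_integral_distr nn_integral_cmult)
  with f c show ?thesis
    unfolding integrable_iff_bounded by (auto simp: ennreal_mult_less_top)
qed

lemma lborel_integral_affine:
  fixes f :: "'a::euclidean_space \<Rightarrow> 'b::{banach, second_countable_topology}"
  assumes f: "integrable lborel f" and c: "c \<noteq> 0"
  shows "(LINT x|lborel. f (t + c *\<^sub>R x)) = (LINT x|lborel. f x) /\<^sub>R (\<bar>c\<bar>^DIM('a))"
proof -
  have [measurable]: "f \<in> borel_measurable borel"
    using borel_measurable_integrable[OF f] by simp
  have "(LINT x|lborel. f x) = (\<bar>c\<bar>^DIM('a)) *\<^sub>R (LINT x|lborel. f (t + c *\<^sub>R x))"
    using lborel_integrable_affine[OF f c]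
    by (subst lborel_affine[OF c, of t]) (simp add: integral_density integral_distr)
  then show ?thesis using c by simp
qed

lemma lborel_integrable_translate:
  fixes f :: "'a::euclidean_space \<Rightarrow> 'b::{banach, second_countable_topology}"
  assumes "integrable lborel f"
  shows "integrable lborel (\<lambda>x. f (x - y))"
  using lborel_integrable_affine[OF assms, of 1 "- y"] by simp

lemma lborel_integral_translate:
  fixes f :: "'a::euclidean_space \<Rightarrow> 'b::{banach, second_countable_topology}"
  assumes "integrable lborel f"
  shows "(LINT x|lborel. f (x - y)) = (LINT x|lborel. f x)"
  using lborel_integral_affine[OF assms, of 1 "- y"] by simp

lemma lborel_integrable_reflect:
  fixes f :: "'a::euclidean_space \<Rightarrow> 'b::{banach, second_countable_topology}"
  assumes "integrable lborel f"
  shows "integrable lborel (\<lambda>y. f (x - y))"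
  using lborel_integrable_affine[OF assms, of "-1" x] by simp

lemma lborel_integral_reflect:
  fixes f :: "'a::euclidean_space \<Rightarrow> 'b::{banach, second_countable_topology}"
  assumes "integrable lborel f"
  shows "(LINT y|lborel. f (x - y)) = (LINT y|lborel. f y)"
  using lborel_integral_affine[OF assms, of "-1" x] by simp

section \<open>Convolution of integrable functions\<close>

definition convolve ::
    "('a::euclidean_space \<Rightarrow> complex) \<Rightarrow> ('a \<Rightarrow> complex) \<Rightarrow> 'a \<Rightarrow> complex" where
  "convolve f g x = (LINT y|lborel. f (x - y) * g y)"

text \<open>Tonelli: integrating in \<open>x\<close> first gives the norm of \<open>f\<close> times
  \<open>norm (g y)\<close>, by translation invariance. Every exchange of integrals in a convolution
  of two L^1 functions rests on this.\<close>

lemma convolve_pair_integrable: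
  fixes f g :: "'a::euclidean_space \<Rightarrow> complex"
  assumes f: "integrable lborel f" and g: "integrable lborel g"
  shows "integrable (lborel \<Otimes>\<^sub>M lborel) (\<lambda>(y, x). f (x - y) * g y)"
proof (rule lborel_pair.Fubini_integrable)
  have [measurable]: "f \<in> borel_measurable borel" "g \<in> borel_measurable borel"
    using borel_measurable_integrable[OF f] borel_measurable_integrable[OF g] by simp_all
  show "(\<lambda>(y, x). f (x - y) * g y) \<in> borel_measurable (lborel \<Otimes>\<^sub>M lborel)"
    by measurable
  have "(LINT x|lborel. norm (f (x - y) * g y)) = (LINT x|lborel. norm (f x)) * norm (g y)" for y
    using lborel_integral_translate[OF integrable_norm[OF f], of y] by (simp add: norm_mult)
  then show "integrable lborel (\<lambda>y. LINT x|lborel. norm (case (y, x) of (y, x) \<Rightarrow> f (x - y) * g y))"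
    using g by simp
  show "AE y in lborel. integrable lborel (\<lambda>x. case (y, x) of (y, x) \<Rightarrow> f (x - y) * g y)"
    using lborel_integrable_translate[OF f] by simp
qed

text \<open>The convolution integral converges only for almost every \<open>x\<close>; elsewhere
  \<open>convolve\<close> takes the default value 0 of the Bochner integral, which Fubini's theorem
  absorbs.\<close>

lemma integrable_convolve:
  fixes f g :: "'a::euclidean_space \<Rightarrow> complex"
  assumes "integrable lborel f" and "integrable lborel g"
  shows "integrable lborel (convolve f g)"
  using lborel_pair.integrable_snd[OF convolve_pair_integrable[OF assms]]
  by (simp add: convolve_def[abs_def])

lemma measurable_convolve [measurable]:
  fixes f g :: "'a::euclidean_space \<Rightarrow> complex"
  assumes [measurable]: "f \<in> borel_measurable borel" "g \<in> borel_measurable borel"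
  shows "convolve f g \<in> borel_measurable borel"
  unfolding convolve_def[abs_def] by measurable

text \<open>Young's inequality in L^1: the triangle inequality under the integral, then
  Tonelli.\<close>

lemma norm_convolve_le:
  fixes f g :: "'a::euclidean_space \<Rightarrow> complex"
  assumes f: "integrable lborel f" and g: "integrable lborel g"
  shows "(LINT x|lborel. norm (convolve f g x))
    \<le> (LINT x|lborel. norm (f x)) * (LINT x|lborel. norm (g x))"
proof -
  have i: "integrable (lborel \<Otimes>\<^sub>M lborel) (\<lambda>(y, x). norm (f (x - y) * g y))"
    using integrable_norm[OF convolve_pair_integrable[OF f g]] by (simp add: case_prod_unfold)
  have "(LINT x|lborel. norm (convolve f g x))
      \<le> (LINT x|lborel. (LINT y|lborel. norm (f (x - y) * g y)))"
    unfolding convolve_def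
    using integrable_norm[OF integrable_convolve[OF f g]] lborel_pair.integrable_snd[OF i]
    by (intro integral_mono integral_norm_bound) (simp_all add: convolve_def[abs_def])
  also have "\<dots> = (LINT y|lborel. (LINT x|lborel. norm (f (x - y) * g y)))"
    using lborel_pair.Fubini_integral[OF i] by simp
  also have "\<dots> = (LINT y|lborel. (LINT x|lborel. norm (f x)) * norm (g y))"
    using lborel_integral_translate[OF integrable_norm[OF f]]
    by (simp add: norm_mult)
  finally show ?thesis by simp
qed

section \<open>The Fourier transform of Borel integrable functions\<close>

lemma fourier_transform_lborel:
  assumes [measurable]: "f \<in> borel_measurable borel"
  shows "fourier_transform f \<xi> = (LINT x|lborel. exp (- \<i> * complex_of_real (x \<bullet> \<xi>)) * f x)"
  unfolding fourier_transform_def by (rule integral_completion) measurable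

lemma norm_character [simp]: "norm (exp (- (\<i> * complex_of_real r))) = 1"
  using norm_exp_i_times[of "- r"] by simp

lemma integrable_character_mult:
  fixes f :: "real ^ 'n \<Rightarrow> complex"
  assumes f: "integrable lborel f"
  shows "integrable lborel (\<lambda>x. exp (- \<i> * complex_of_real (x \<bullet> \<xi>)) * f x)"
proof -
  have [measurable]: "f \<in> borel_measurable borel"
    using borel_measurable_integrable[OF f] by simp
  show ?thesis
    by (rule Bochner_Integration.integrable_bound[OF f]) (auto simp: norm_mult)
qed

lemma fourier_transform_convolve:
  fixes f g :: "real ^ 'n \<Rightarrow> complex"
  assumes f: "integrable lborel f" and g: "integrable lborel g"
  shows "fourier_transform (convolve f g) \<xi> = fourier_transform f \<xi> * fourier_transform g \<xi>"
proof -
  have [measurable]: "f \<in> borel_measurable borel" "g \<in> borel_measurable borel"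
    using borel_measurable_integrable[OF f] borel_measurable_integrable[OF g] by simp_all
  let ?e = "\<lambda>x. exp (- \<i> * complex_of_real (x \<bullet> \<xi>))"
  have i: "integrable (lborel \<Otimes>\<^sub>M lborel) (\<lambda>(y, x). ?e x * (f (x - y) * g y))"
    by (rule Bochner_Integration.integrable_bound[OF convolve_pair_integrable[OF f g]])
       (auto simp: norm_mult)
  \<comment> \<open>The character is multiplicative along x = (x - y) + y, so after Fubini the inner
    integral is a translate of the one defining the transform of \<open>f\<close>.\<close>
  have e: "?e x = ?e (x - y) * ?e y" for x y
    by (simp add: exp_add[symmetric] inner_diff_left algebra_simps)
  have "fourier_transform (convolve f g) \<xi> = (LINT x|lborel. (LINT y|lborel. ?e x * (f (x - y) * g y)))"
    by (simp add: fourier_transform_lborel convolve_def)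
  also have "\<dots> = (LINT y|lborel. (LINT x|lborel. ?e x * (f (x - y) * g y)))"
    using lborel_pair.Fubini_integral[OF i] by simp
  also have "\<dots> = (LINT y|lborel. (LINT x|lborel. ?e (x - y) * f (x - y)) * (?e y * g y))"
  proof (intro Bochner_Integration.integral_cong refl)
    fix y
    have "(\<lambda>x. ?e x * (f (x - y) * g y)) = (\<lambda>x. ?e (x - y) * f (x - y) * (?e y * g y))"
      by (intro ext, subst e[of _ y]) (simp only: mult_ac)
    then show "(LINT x|lborel. ?e x * (f (x - y) * g y)) = (LINT x|lborel. ?e (x - y) * f (x - y)) * (?e y * g y)"
      by (simp only: integral_mult_left_zero)
  qed
  also have "\<dots> = (LINT y|lborel. (LINT x|lborel. ?e x * f x) * (?e y * g y))"
    using lborel_integral_translate[OF integrable_character_mult[OF f]] by simp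
  also have "\<dots> = fourier_transform f \<xi> * fourier_transform g \<xi>"
    by (simp add: fourier_transform_lborel)
  finally show ?thesis .
qed

text \<open>Dominated convergence with majorant |f|, since characters have modulus one.\<close>

lemma isCont_fourier_transform:
  fixes f :: "real ^ 'n \<Rightarrow> complex"
  assumes f: "integrable lborel f"
  shows "isCont (fourier_transform f) \<xi>"
  unfolding continuous_at_sequentially comp_def
proof (intro allI impI)
  fix X :: "nat \<Rightarrow> real ^ 'n" assume X: "X \<longlonglongrightarrow> \<xi>"
  have [measurable]: "f \<in> borel_measurable borel"
    using borel_measurable_integrable[OF f] by simp
  show "(\<lambda>n. fourier_transform f (X n)) \<longlonglongrightarrow> fourier_transform f \<xi>"
    unfolding fourier_transform_lborel[OF \<open>f \<in> borel_measurable borel\<close>]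
    by (rule integral_dominated_convergence[where w="\<lambda>x. norm (f x)"])
       (use f X in \<open>auto simp: norm_mult intro!: tendsto_intros\<close>)
qed

section \<open>Integrals of products of one-variable functions\<close>

lemma
  fixes f :: "'a::euclidean_space \<Rightarrow> real \<Rightarrow> 'b::{real_normed_field, banach, second_countable_topology}"
  assumes f: "\<And>b. b \<in> Basis \<Longrightarrow> integrable lborel (f b)"
  shows lborel_integrable_prod_Basis: "integrable lborel (\<lambda>x. \<Prod>b\<in>Basis. f b (x \<bullet> b))" (is ?I)
    and lborel_integral_prod_Basis:
      "(LINT x|lborel. (\<Prod>b\<in>Basis. f b (x \<bullet> b))) = (\<Prod>b\<in>Basis. (LINT u|lborel. f b u))" (is ?E)
proof -
  interpret product_sigma_finite "\<lambda>b::'a. lborel :: real measure" ..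
  have [measurable]: "f b \<in> borel_measurable borel" if "b \<in> Basis" for b
    using borel_measurable_integrable[OF f[OF that]] by simp
  let ?g = "\<lambda>x::'a. \<Prod>b\<in>Basis. f b (x \<bullet> b)"
  have g: "?g \<in> borel_measurable borel" by measurable
  have *: "?g (\<Sum>b\<in>Basis. x b *\<^sub>R b) = (\<Prod>b\<in>Basis. f b (x b))" for x
    by (intro prod.cong refl) simp
  \<comment> \<open>Lebesgue measure is the image of the product of one-dimensional Lebesgue
    measures under the map from coordinates to vectors, so Fubini for finite products
    applies.\<close>
  show ?I
    by (subst lborel_eq, subst integrable_distr_eq) (auto simp: * f g intro!: product_integrable_prod)
  show ?E
    by (subst lborel_eq, subst integral_distr) (auto simp: * f g intro!: product_integral_prod)
qed

lemma
  fixes f :: "'n::finite \<Rightarrow> real \<Rightarrow> 'b::{real_normed_field, banach, second_countable_topology}"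
  assumes f: "\<And>i. integrable lborel (f i)"
  shows lborel_integrable_prod_vec: "integrable lborel (\<lambda>x::real^'n. \<Prod>i\<in>UNIV. f i (x $ i))" (is ?I)
    and lborel_integral_prod_vec:
      "(LINT x|lborel. (\<Prod>i\<in>UNIV. f i ((x::real^'n) $ i))) = (\<Prod>i\<in>UNIV. (LINT u|lborel. f i u))" (is ?E)
proof -
  \<comment> \<open>Re-indexes the family by basis vectors instead of coordinates; only values at
    vectors \<open>axis i 1\<close> are ever used.\<close>
  define g where "g b = f (THE i. b = axis i (1::real))" for b :: "real^'n"
  have g: "g (axis i 1) = f i" for i
    unfolding g_def by (rule arg_cong[of _ _ f]) (auto simp: axis_eq_axis)
  have B: "(Basis :: (real^'n) set) = (\<lambda>i. axis i 1) ` UNIV"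
    by (auto simp: Basis_vec_def)
  have inj: "inj (\<lambda>i::'n. axis i (1::real))"
    by (auto simp: inj_on_def axis_eq_axis)
  have i: "integrable lborel (g b)" if "b \<in> Basis" for b
    using that f by (auto simp: B g)
  have *: "(\<Prod>b\<in>Basis. F b) = (\<Prod>i\<in>UNIV. F (axis i 1))" for F :: "real^'n \<Rightarrow> 'b"
    unfolding B by (simp add: prod.reindex[OF inj])
  show ?I using lborel_integrable_prod_Basis[of g, OF i] by (simp add: * g inner_axis)
  show ?E using lborel_integral_prod_Basis[of g, OF i] by (simp add: * g inner_axis)
qed

section \<open>Gaussian derivatives\<close>

text \<open>Parabolic scaling, normalised to preserve the L^1 norm: it carries the heat kernel at
  time 1 to the one at time \<open>s\<close>.\<close>

definition dilate :: "real \<Rightarrow> (real ^ 'n \<Rightarrow> complex) \<Rightarrow> real ^ 'n \<Rightarrow> complex" where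
  "dilate s f x = complex_of_real (s powr (- real CARD('n) / 2)) * f (x /\<^sub>R sqrt s)"

lemma sqrt_inverse_power_dim:
  assumes "s > 0"
  shows "inverse (sqrt s) ^ n = s powr (- real n / 2)"
proof -
  have "inverse (sqrt s) = s powr (- (1 / 2))"
    using assms by (simp add: powr_minus powr_half_sqrt)
  then show ?thesis
    using assms by (simp add: powr_power)
qed

lemma
  fixes f :: "real ^ 'n \<Rightarrow> complex"
  assumes f: "integrable lborel f" and s: "s > 0"
  shows integrable_dilate: "integrable lborel (dilate s f)"
    and integral_norm_dilate: "(LINT x|lborel. norm (dilate s f x)) = (LINT x|lborel. norm (f x))"
proof -
  show "integrable lborel (dilate s f)"
    unfolding dilate_def[abs_def]
    using lborel_integrable_affine[OF f, of "inverse (sqrt s)" 0] s by simp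
  have "(LINT x|lborel. norm (f (x /\<^sub>R sqrt s))) = (LINT x|lborel. norm (f x)) / s powr (- real CARD('n) / 2)"
  proof -
    have "\<bar>inverse (sqrt s)\<bar> ^ DIM(real ^ 'n) = s powr (- real CARD('n) / 2)"
      using s sqrt_inverse_power_dim[OF s, of "CARD('n)"] by simp
    with lborel_integral_affine[OF integrable_norm[OF f], of "inverse (sqrt s)" 0] s
    show ?thesis by (simp only: real_scaleR_def divide_inverse_commute add_0) simp
  qed
  then show "(LINT x|lborel. norm (dilate s f x)) = (LINT x|lborel. norm (f x))"
    using s by (simp add: dilate_def norm_mult)
qed

lemma fourier_transform_dilate:
  fixes f :: "real ^ 'n \<Rightarrow> complex"
  assumes f: "integrable lborel f" and s: "s > 0"
  shows "fourier_transform (dilate s f) \<xi> = fourier_transform f (sqrt s *\<^sub>R \<xi>)"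
proof -
  have [measurable]: "f \<in> borel_measurable borel"
    using borel_measurable_integrable[OF f] by simp
  have [measurable]: "dilate s f \<in> borel_measurable borel"
    unfolding dilate_def[abs_def] by measurable
  have *: "(x /\<^sub>R sqrt s) \<bullet> (sqrt s *\<^sub>R \<xi>) = x \<bullet> \<xi>" for x
    using s by simp
  have "(LINT x|lborel. exp (- \<i> * complex_of_real (x \<bullet> \<xi>)) * f (x /\<^sub>R sqrt s))
     = fourier_transform f (sqrt s *\<^sub>R \<xi>) /\<^sub>R (s powr (- real CARD('n) / 2))"
    using lborel_integral_affine[OF integrable_character_mult[OF f, of "sqrt s *\<^sub>R \<xi>"], of "inverse (sqrt s)" 0] s
    unfolding add_0 * by (simp add: sqrt_inverse_power_dim fourier_transform_lborel)
  moreover have "fourier_transform (dilate s f) \<xi> = complex_of_real (s powr (- real CARD('n) / 2)) *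
     (LINT x|lborel. exp (- \<i> * complex_of_real (x \<bullet> \<xi>)) * f (x /\<^sub>R sqrt s))"
    by (subst integral_mult_right_zero[symmetric])
       (simp add: fourier_transform_lborel dilate_def mult_ac)
  ultimately show ?thesis
    using s by (simp add: scaleR_conv_of_real)
qed

section \<open>Derivatives of the one-dimensional Gaussian\<close>

primrec hermite_factor :: "nat \<Rightarrow> real poly" where
  "hermite_factor 0 = 1"
| "hermite_factor (Suc k) = pderiv (hermite_factor k) - [:0, 1/2:] * hermite_factor k"

text \<open>The k-th derivative of exp(-u^2/4): differentiating p(u) exp(-u^2/4) replaces p by p' -
  (u/2) p, which is the recursion of \<open>hermite_factor\<close>. That polynomial is (-1/2)^k
  H_k(u/2), with H_k the physicists' Hermite polynomial.\<close>

definition gauss_deriv :: "nat \<Rightarrow> real \<Rightarrow> real" where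
  "gauss_deriv k u = poly (hermite_factor k) u * exp (- u\<^sup>2 / 4)"

lemma DERIV_gauss_deriv: "(gauss_deriv k has_real_derivative gauss_deriv (Suc k) u) (at u)"
  unfolding gauss_deriv_def[abs_def]
  by (auto intro!: derivative_eq_intros simp: field_simps)

lemma continuous_gauss_deriv: "continuous_on UNIV (gauss_deriv k)"
  using DERIV_gauss_deriv by (meson DERIV_isCont continuous_at_imp_continuous_on)

lemma measurable_gauss_deriv [measurable]: "gauss_deriv k \<in> borel_measurable borel"
  by (rule borel_measurable_continuous_onI[OF continuous_gauss_deriv])

text \<open>Induction on the polynomial: the factor \<open>u\<close> and the remaining polynomial
  each consume half of the exponent, so the exponent \<open>e\<close> must vary in the
  induction.\<close>

lemma poly_le_exp_square:
  fixes p :: "real poly"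
  assumes "e > 0"
  shows "\<exists>C\<ge>0. \<forall>u. \<bar>poly p u\<bar> \<le> C * exp (e * u\<^sup>2)"
  using assms
proof (induction p arbitrary: e)
  case 0
  show ?case by (intro exI[of _ 0]) simp
next
  case (pCons a p)
  obtain C where C: "C \<ge> 0" "\<And>u. \<bar>poly p u\<bar> \<le> C * exp (e / 2 * u\<^sup>2)"
    using pCons.IH[of "e / 2"] pCons.prems by auto
  \<comment> \<open>This is what 1 + u^2 \<le> D (1 + (e/2) u^2) requires.\<close>
  define D where "D = 1 + 2 / e"
  have D: "\<bar>u\<bar> \<le> D * exp (e / 2 * u\<^sup>2)" for u
  proof -
    have "0 \<le> (\<bar>u\<bar> - 1)\<^sup>2" by simp
    then have "\<bar>u\<bar> \<le> 1 + u\<^sup>2" by (simp add: power2_eq_square algebra_simps abs_if split: if_splits)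
    also have "\<dots> \<le> D * (1 + e / 2 * u\<^sup>2)"
      using pCons.prems by (simp add: D_def field_simps)
    also have "\<dots> \<le> D * exp (e / 2 * u\<^sup>2)"
      using pCons.prems exp_ge_add_one_self[of "e / 2 * u\<^sup>2"] by (intro mult_left_mono) (auto simp: D_def)
    finally show ?thesis .
  qed
  have "\<bar>poly (pCons a p) u\<bar> \<le> (\<bar>a\<bar> + D * C) * exp (e * u\<^sup>2)" for u
  proof -
    have "\<bar>poly (pCons a p) u\<bar> \<le> \<bar>a\<bar> + \<bar>u\<bar> * \<bar>poly p u\<bar>"
      by (metis abs_mult abs_triangle_ineq poly_pCons)
    also have "\<dots> \<le> \<bar>a\<bar> + (D * exp (e / 2 * u\<^sup>2)) * (C * exp (e / 2 * u\<^sup>2))"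
      using D[of u] C pCons.prems by (intro add_left_mono mult_mono) (auto simp: D_def)
    also have "\<dots> = \<bar>a\<bar> + D * C * exp (e * u\<^sup>2)"
      by (simp add: exp_add[symmetric] mult_ac)
    also have "\<dots> \<le> \<bar>a\<bar> * exp (e * u\<^sup>2) + D * C * exp (e * u\<^sup>2)"
      using pCons.prems by (intro add_right_mono) (simp add: mult_le_cancel_left1)
    finally show ?thesis by (simp add: algebra_simps)
  qed
  then show ?case
    using C pCons.prems by (intro exI[of _ "\<bar>a\<bar> + D * C"]) (auto simp: D_def)
qed

text \<open>Half of the Gaussian decay is spent on absorbing the Hermite polynomial.\<close>

lemma gauss_deriv_bound: "\<exists>C\<ge>0. \<forall>u. \<bar>gauss_deriv k u\<bar> \<le> C * exp (- u\<^sup>2 / 8)"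
proof -
  obtain C where C: "C \<ge> 0" "\<And>u. \<bar>poly (hermite_factor k) u\<bar> \<le> C * exp (1/8 * u\<^sup>2)"
    using poly_le_exp_square[of "1/8" "hermite_factor k"] by auto
  have "\<bar>gauss_deriv k u\<bar> \<le> C * exp (- u\<^sup>2 / 8)" for u
  proof -
    have "\<bar>gauss_deriv k u\<bar> \<le> C * exp (1/8 * u\<^sup>2) * exp (- u\<^sup>2 / 4)"
      unfolding gauss_deriv_def abs_mult by (intro mult_mono C) (auto simp: C)
    also have "\<dots> = C * exp (- u\<^sup>2 / 8)"
      by (simp add: exp_add[symmetric] mult.assoc)
    finally show ?thesis .
  qed
  with C show ?thesis by blast
qed

lemma integrable_gauss_deriv: "integrable lborel (gauss_deriv k)"
proof -
  obtain C where C: "\<And>u. \<bar>gauss_deriv k u\<bar> \<le> C * exp (- u\<^sup>2 / 8)"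
    using gauss_deriv_bound by blast
  \<comment> \<open>The majorant exp(-u^2/8) is the normal density of standard deviation 2 without
    its normalisation.\<close>
  have "integrable lborel (\<lambda>u. sqrt (8 * pi) * normal_density 0 2 u)"
    by simp
  then have "integrable lborel (\<lambda>u::real. C * exp (- u\<^sup>2 / 8))"
    by (simp add: normal_density_def)
  then show ?thesis
    by (rule Bochner_Integration.integrable_bound) (auto intro!: AE_I2 order_trans[OF C] abs_ge_self)
qed

lemma fourier_gauss:
  "(CLBINT u. exp (- \<i> * complex_of_real (u * \<eta>)) * complex_of_real ((4 * pi) powr (- 1 / 2) * gauss_deriv 0 u))
     = complex_of_real (exp (- \<eta>\<^sup>2))"
proof -
  let ?F = "\<lambda>u::real. exp (- \<i> * complex_of_real (u * \<eta>)) * complex_of_real ((4 * pi) powr (- 1 / 2) * gauss_deriv 0 u)"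
  \<comment> \<open>The Gaussian here has variance 2, whence u = sqrt 2 z with z standard normal;
    the minus sign matches the sign convention of the Fourier transform.\<close>
  let ?s = "- sqrt 2 * \<eta>"
  have "char std_normal_distribution ?s = complex_of_real (exp (- (?s\<^sup>2) / 2))"
    by (simp add: char_std_normal_distribution)
  also have "- (?s\<^sup>2) / 2 = - \<eta>\<^sup>2" by (simp add: power_mult_distrib)
  finally have 1: "char std_normal_distribution ?s = complex_of_real (exp (- \<eta>\<^sup>2))" .
  have "char std_normal_distribution ?s = (CLBINT z. std_normal_density z *\<^sub>R exp (\<i> * complex_of_real (?s * z)))"
    unfolding char_def by (subst integral_density) auto
  also have "\<dots> = (CLBINT z. sqrt 2 *\<^sub>R ?F (0 + sqrt 2 * z))"
  proof (intro Bochner_Integration.integral_cong refl)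
    fix z
    have "sqrt 2 * ((4 * pi) powr (- 1 / 2)) = 1 / sqrt (2 * pi)"
      by (simp add: powr_minus_divide powr_half_sqrt real_sqrt_mult field_simps)
    then have "std_normal_density z = sqrt 2 * ((4 * pi) powr (- 1 / 2) * gauss_deriv 0 (sqrt 2 * z))"
      by (simp add: std_normal_density_def gauss_deriv_def power_mult_distrib flip: mult.assoc)
    then show "std_normal_density z *\<^sub>R exp (\<i> * complex_of_real (?s * z)) = sqrt 2 *\<^sub>R ?F (0 + sqrt 2 * z)"
      by (simp add: scaleR_conv_of_real mult_ac)
  qed
  also have "\<dots> = (CLBINT u. ?F u)"
    using lborel_integral_real_affine[of "sqrt 2" ?F 0] by simp
  finally show ?thesis using 1 by simp
qed

text \<open>\<open>heat_deriv \<gamma> t\<close> is \<open>\<partial>\<^sup>\<gamma> G(\<sqdot>, t)\<close>, written so that its parabolic scaling in \<open>t\<close> is visible.\<close>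

definition heat_deriv :: "('n \<Rightarrow> nat) \<Rightarrow> real \<Rightarrow> real ^ 'n \<Rightarrow> complex" where
  "heat_deriv \<gamma> t x = complex_of_real ((4 * pi * t) powr (- real CARD('n) / 2) *
     t powr (- real (\<Sum>i\<in>UNIV. \<gamma> i) / 2) * (\<Prod>i\<in>UNIV. gauss_deriv (\<gamma> i) (x $ i / sqrt t)))"

lemma norm_vec_power2: "(norm (x :: real ^ 'n))\<^sup>2 = (\<Sum>i\<in>UNIV. (x $ i)\<^sup>2)"
  unfolding power2_norm_eq_inner by (simp add: inner_vec_def power2_eq_square)

lemma heat_deriv_0:
  assumes "t > 0"
  shows "heat_deriv (\<lambda>_. 0) t = (heat_kernel t :: real ^ 'n \<Rightarrow> complex)"
proof
  fix x :: "real ^ 'n"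
  have "(\<Prod>i\<in>UNIV. gauss_deriv 0 (x $ i / sqrt t)) = exp (\<Sum>i\<in>UNIV. - (x $ i / sqrt t)\<^sup>2 / 4)"
    by (simp add: gauss_deriv_def exp_sum)
  also have "(\<Sum>i\<in>UNIV. - (x $ i / sqrt t)\<^sup>2 / 4) = - (norm x)\<^sup>2 / (4 * t)"
    using assms by (simp add: norm_vec_power2 sum_negf sum_divide_distrib power_divide mult.commute)
  finally show "heat_deriv (\<lambda>_. 0) t x = heat_kernel t x"
    using assms by (simp add: heat_deriv_def heat_kernel_def)
qed

lemma heat_deriv_eq_dilate:
  assumes "t > 0"
  shows "heat_deriv \<gamma> t x = complex_of_real (t powr (- real (\<Sum>i\<in>UNIV. \<gamma> i) / 2)) * dilate t (heat_deriv \<gamma> 1) x"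
  using assms by (simp add: heat_deriv_def dilate_def powr_mult divide_inverse_commute[symmetric])

lemma heat_kernel_eq_dilate:
  assumes "t > 0"
  shows "heat_kernel t = dilate t (heat_kernel 1)"
  using heat_deriv_eq_dilate[OF assms, of "\<lambda>_. 0"] assms by (auto simp: heat_deriv_0)

lemma integrable_heat_deriv:
  assumes "t > 0"
  shows "integrable lborel (heat_deriv \<gamma> t :: real ^ 'n \<Rightarrow> complex)"
proof -
  have "integrable lborel (heat_deriv \<gamma> 1 :: real ^ 'n \<Rightarrow> complex)"
    using lborel_integrable_prod_vec[of "\<lambda>i. gauss_deriv (\<gamma> i)"] integrable_gauss_deriv
    unfolding heat_deriv_def[abs_def] by (simp del: of_real_prod)
  then show ?thesis
    unfolding heat_deriv_eq_dilate[OF assms, abs_def]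
    by (intro integrable_mult_right integrable_dilate assms)
qed

text \<open>The source of the factor t^(-|\<gamma>|/2) in the decay rate: dilations keep the L^1
  norm, so only the prefactor of the scaling law remains.\<close>

lemma integral_norm_heat_deriv:
  assumes "t > 0"
  shows "(LINT x|lborel. norm (heat_deriv \<gamma> t (x :: real ^ 'n)))
    = t powr (- real (\<Sum>i\<in>UNIV. \<gamma> i) / 2) * (LINT x|lborel. norm (heat_deriv \<gamma> 1 (x :: real ^ 'n)))"
  unfolding heat_deriv_eq_dilate[OF assms, of \<gamma>] norm_mult
  using integral_norm_dilate[OF integrable_heat_deriv[of 1 \<gamma>] assms] by simp

lemma continuous_heat_deriv: "continuous_on UNIV (heat_deriv \<gamma> t :: real ^ 'n \<Rightarrow> complex)"
  unfolding heat_deriv_def[abs_def] divide_inverse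
  by (intro continuous_intros continuous_on_compose2[OF continuous_gauss_deriv]) auto

lemma measurable_heat_deriv [measurable]: "heat_deriv \<gamma> t \<in> borel_measurable borel"
  by (rule borel_measurable_continuous_onI[OF continuous_heat_deriv])

lemma heat_deriv_bounded: "\<exists>B. \<forall>x. norm (heat_deriv \<gamma> t (x :: real ^ 'n)) \<le> B"
proof -
  have "\<exists>C. \<forall>u. \<bar>gauss_deriv k u\<bar> \<le> C" for k
  proof -
    obtain C where C: "C \<ge> 0" "\<And>u. \<bar>gauss_deriv k u\<bar> \<le> C * exp (- u\<^sup>2 / 8)"
      using gauss_deriv_bound by blast
    have "\<bar>gauss_deriv k u\<bar> \<le> C" for u
      using order_trans[OF C(2)[of u] mult_left_le[OF _ C(1)]] by simp
    then show ?thesis by blast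
  qed
  then obtain C where C: "\<And>k u. \<bar>gauss_deriv k u\<bar> \<le> C k" by metis
  have "\<bar>\<Prod>i\<in>UNIV. gauss_deriv (\<gamma> i) (x $ i / sqrt t)\<bar> \<le> (\<Prod>i\<in>UNIV. C (\<gamma> i))" for x :: "real ^ 'n"
    unfolding abs_prod by (intro prod_mono) (auto intro: C)
  then have "norm (heat_deriv \<gamma> t x) \<le> \<bar>(4 * pi * t) powr (- real CARD('n) / 2) *
     t powr (- real (\<Sum>i\<in>UNIV. \<gamma> i) / 2)\<bar> * (\<Prod>i\<in>UNIV. C (\<gamma> i))" for x :: "real ^ 'n"
    unfolding heat_deriv_def norm_of_real by (subst abs_mult) (intro mult_left_mono, auto)
  then show ?thesis by blast
qed

lemma heat_deriv_has_vector_derivative: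
  fixes x :: "real ^ 'n"
  assumes t: "t > 0"
  shows "((\<lambda>s. heat_deriv \<gamma> t (x + s *\<^sub>R axis i 1)) has_vector_derivative
     heat_deriv (\<gamma>(i := Suc (\<gamma> i))) t (x + s *\<^sub>R axis i 1)) (at s)"
proof -
  define c where "c = (4 * pi * t) powr (- real CARD('n) / 2) * t powr (- real (\<Sum>i\<in>UNIV. \<gamma> i) / 2)"
  \<comment> \<open>The factors that stay constant when the point moves in direction
    \<open>i\<close>.\<close>
  define P where "P = (\<Prod>j\<in>UNIV - {i}. gauss_deriv (\<gamma> j) (x $ j / sqrt t))"
  have split: "(\<Prod>j\<in>UNIV. F j) = F i * (\<Prod>j\<in>UNIV-{i}. F j)" for F :: "'n \<Rightarrow> real"
    by (rule prod.remove) auto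
  have e: "heat_deriv \<gamma> t (x + s *\<^sub>R axis i 1) =
      complex_of_real (c * (gauss_deriv (\<gamma> i) ((x $ i + s) / sqrt t) * P))" for s
    unfolding heat_deriv_def c_def P_def split
    by (auto simp: axis_def intro!: prod.cong)
  have S: "(\<Sum>j\<in>UNIV. (\<gamma>(i := Suc (\<gamma> i))) j) = Suc (\<Sum>j\<in>UNIV. \<gamma> j)"
    by (simp add: sum.remove[of UNIV i])
  \<comment> \<open>Raising the order by one absorbs the factor 1 / sqrt t of the chain
    rule.\<close>
  have p: "t powr (- real (Suc (\<Sum>j\<in>UNIV. \<gamma> j)) / 2) = t powr (- real (\<Sum>j\<in>UNIV. \<gamma> j) / 2) / sqrt t"
  proof -
    have "- real (Suc (\<Sum>j\<in>UNIV. \<gamma> j)) / 2 = - real (\<Sum>j\<in>UNIV. \<gamma> j) / 2 - 1 / 2"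
      by (simp add: field_simps)
    then show ?thesis using t by (simp only: powr_diff powr_half_sqrt less_imp_le)
  qed
  have e': "heat_deriv (\<gamma>(i := Suc (\<gamma> i))) t (x + s *\<^sub>R axis i 1) =
      complex_of_real (c * (gauss_deriv (Suc (\<gamma> i)) ((x $ i + s) / sqrt t) * (1 / sqrt t) * P))" for s
    unfolding heat_deriv_def c_def P_def split S p
    by (auto simp: axis_def intro!: prod.cong)
  have "((\<lambda>s. gauss_deriv (\<gamma> i) ((x $ i + s) / sqrt t)) has_real_derivative
      gauss_deriv (Suc (\<gamma> i)) ((x $ i + s) / sqrt t) * (1 / sqrt t)) (at s)"
    by (intro DERIV_chain2[OF DERIV_gauss_deriv] DERIV_cdivide) (auto intro!: derivative_eq_intros)
  from DERIV_cmult[OF DERIV_cmult_right[OF this, of P], of c]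
  have "((\<lambda>s. c * (gauss_deriv (\<gamma> i) ((x $ i + s) / sqrt t) * P)) has_real_derivative
      c * (gauss_deriv (Suc (\<gamma> i)) ((x $ i + s) / sqrt t) * (1 / sqrt t) * P)) (at s)" .
  then show ?thesis
    unfolding e e' by (intro has_vector_derivative_of_real) (simp add: has_real_derivative_iff_has_vector_derivative)
qed

text \<open>At time 1 the kernel and the character both factor over the coordinates, which reduces
  the claim to \<open>fourier_gauss\<close>; other times follow by dilation.\<close>

lemma fourier_transform_heat_kernel:
  assumes t: "t > 0"
  shows "fourier_transform (heat_kernel t) \<xi> = complex_of_real (exp (- t * (norm (\<xi> :: real ^ 'n))\<^sup>2))"
proof -
  have i: "integrable lborel (heat_kernel 1 :: real ^ 'n \<Rightarrow> complex)"
    using integrable_heat_deriv[of 1 "\<lambda>_. 0"] by (simp add: heat_deriv_0)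
  have 1: "fourier_transform (heat_kernel 1) \<eta> = complex_of_real (exp (- (norm \<eta>)\<^sup>2))" for \<eta> :: "real ^ 'n"
  proof -
    let ?f = "\<lambda>i u. exp (- \<i> * complex_of_real (u * \<eta> $ i)) * complex_of_real ((4 * pi) powr (- 1 / 2) * gauss_deriv 0 u)"
    have f: "integrable lborel (?f i)" for i
    proof -
      have "integrable lborel (\<lambda>u. complex_of_real ((4 * pi) powr (- 1 / 2) * gauss_deriv 0 u))"
        using integrable_gauss_deriv by simp
      then show ?thesis
        by (rule Bochner_Integration.integrable_bound) (auto simp: norm_mult simp del: of_real_mult)
    qed
    have k: "heat_kernel 1 x = (\<Prod>i\<in>UNIV. complex_of_real ((4 * pi) powr (- 1 / 2) * gauss_deriv 0 (x $ i)))" for x :: "real ^ 'n"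
    proof -
      have "(\<Prod>i\<in>(UNIV::'n set). (4 * pi) powr (- 1 / 2)) = (4 * pi) powr (- real CARD('n) / 2)"
        by (simp add: powr_realpow[symmetric] powr_powr)
      then show ?thesis
        unfolding of_real_prod[symmetric] prod.distrib
        by (subst heat_deriv_0[symmetric]) (auto simp: heat_deriv_def)
    qed
    have e: "exp (- \<i> * complex_of_real (x \<bullet> \<eta>)) = (\<Prod>i\<in>UNIV. exp (- \<i> * complex_of_real (x $ i * \<eta> $ i)))" for x
      by (simp add: inner_vec_def exp_sum[symmetric] sum_distrib_left sum_negf)
    have "fourier_transform (heat_kernel 1) \<eta> = (LINT x|lborel. (\<Prod>i\<in>UNIV. ?f i (x $ i)))"
      using borel_measurable_integrable[OF i]
      by (subst fourier_transform_lborel) (simp, simp only: e k prod.distrib)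
    also have "\<dots> = (\<Prod>i\<in>UNIV. complex_of_real (exp (- (\<eta> $ i)\<^sup>2)))"
      by (subst lborel_integral_prod_vec[OF f]) (simp only: fourier_gauss)
    also have "\<dots> = complex_of_real (exp (- (norm \<eta>)\<^sup>2))"
      by (simp only: of_real_prod[symmetric]) (simp add: exp_sum[symmetric] norm_vec_power2 sum_negf)
    finally show ?thesis .
  qed
  show ?thesis
    unfolding heat_kernel_eq_dilate[OF t] fourier_transform_dilate[OF i t] 1
    using t by (simp add: power_mult_distrib)
qed

section \<open>Convolution with the heat kernel and Fourier uniqueness\<close>

text \<open>A bounded function times an integrable one: these convolutions converge at every point,
  not just almost everywhere.\<close>

lemma integrable_convolve_integrand:
  fixes f :: "real ^ 'n \<Rightarrow> complex"
  assumes f: "integrable lborel f"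
  shows "integrable lborel (\<lambda>y. heat_deriv \<gamma> t (x - y) * f y)"
proof -
  obtain B where B: "\<And>x. norm (heat_deriv \<gamma> t (x :: real ^ 'n)) \<le> B"
    using heat_deriv_bounded by blast
  have [measurable]: "f \<in> borel_measurable borel"
    using borel_measurable_integrable[OF f] by simp
  have "B \<ge> 0" using B[of 0] norm_ge_zero order_trans by blast
  show ?thesis
  proof (rule Bochner_Integration.integrable_bound)
    show "integrable lborel (\<lambda>y. B *\<^sub>R f y)" using f by simp
    show "AE y in lborel. norm (heat_deriv \<gamma> t (x - y) * f y) \<le> norm (B *\<^sub>R f y)"
      using B \<open>B \<ge> 0\<close> by (intro AE_I2) (simp add: norm_mult mult_right_mono)
  qed measurable
qed

text \<open>Dominated convergence with majorant B |f|. Convolution with the heat kernel thus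
  provides the continuous representatives that Fourier uniqueness is applied to.\<close>

lemma continuous_convolve_heat_deriv:
  fixes f :: "real ^ 'n \<Rightarrow> complex"
  assumes f: "integrable lborel f"
  shows "continuous_on UNIV (convolve (heat_deriv \<gamma> t) f)"
proof -
  obtain B where B: "\<And>x. norm (heat_deriv \<gamma> t (x :: real ^ 'n)) \<le> B"
    using heat_deriv_bounded by blast
  have [measurable]: "f \<in> borel_measurable borel"
    using borel_measurable_integrable[OF f] by simp
  have c: "isCont (heat_deriv \<gamma> t) z" for z :: "real ^ 'n"
    using continuous_heat_deriv continuous_on_eq_continuous_at by blast
  have "isCont (convolve (heat_deriv \<gamma> t) f) x" for x
    unfolding continuous_at_sequentially comp_def
  proof (intro allI impI)
    fix X assume X: "X \<longlonglongrightarrow> x"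
    show "(\<lambda>n. convolve (heat_deriv \<gamma> t) f (X n)) \<longlonglongrightarrow> convolve (heat_deriv \<gamma> t) f x"
      unfolding convolve_def
    proof (rule integral_dominated_convergence[where w="\<lambda>y. B * norm (f y)"])
      show "integrable lborel (\<lambda>y. B * norm (f y))" using f by simp
      show "AE y in lborel. (\<lambda>n. heat_deriv \<gamma> t (X n - y) * f y) \<longlonglongrightarrow> heat_deriv \<gamma> t (x - y) * f y"
        by (intro AE_I2 tendsto_intros isCont_tendsto_compose[OF c] X)
      show "AE y in lborel. norm (heat_deriv \<gamma> t (X n - y) * f y) \<le> B * norm (f y)" for n
        using B by (intro AE_I2) (simp add: norm_mult mult_right_mono)
    qed measurable
  qed
  then show ?thesis by (simp add: continuous_at_imp_continuous_on)
qed

text \<open>The difference-quotient form lets derivatives be tested along sequences, hence by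
  dominated convergence.\<close>

lemma has_vector_derivative_at_0_iff_quotient:
  fixes g :: "real \<Rightarrow> 'a::real_normed_vector"
  shows "(g has_vector_derivative D) (at 0) \<longleftrightarrow> ((\<lambda>s. (g s - g 0) /\<^sub>R s) \<longlongrightarrow> D) (at 0)"
proof -
  have "(g has_vector_derivative D) (at 0) \<longleftrightarrow> ((\<lambda>h. norm (g h - g 0 - h *\<^sub>R D) / norm h) \<longlongrightarrow> 0) (at 0)"
    unfolding has_vector_derivative_def has_derivative_at
    by (simp add: bounded_linear_scaleR_left)
  also have "\<dots> \<longleftrightarrow> ((\<lambda>h. norm ((g h - g 0) /\<^sub>R h - D)) \<longlongrightarrow> 0) (at 0)"
  proof (rule tendsto_cong, unfold eventually_at_filter, intro always_eventually allI impI)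
    fix h :: real assume h: "h \<noteq> 0"
    have "(g h - g 0) /\<^sub>R h - D = (g h - g 0 - h *\<^sub>R D) /\<^sub>R h"
      using h by (simp add: scaleR_diff_right)
    then show "norm (g h - g 0 - h *\<^sub>R D) / norm h = norm ((g h - g 0) /\<^sub>R h - D)"
      by (simp add: divide_inverse_commute)
  qed
  also have "\<dots> \<longleftrightarrow> ((\<lambda>s. (g s - g 0) /\<^sub>R s) \<longlongrightarrow> D) (at 0)"
    by (simp add: tendsto_norm_zero_iff LIM_zero_iff)
  finally show ?thesis .
qed

text \<open>Differentiation under the integral sign: the next derivative of the kernel is bounded by
  some B, so the difference quotients are too, and B |f| is a majorant.\<close>

lemma partial_deriv_convolve_heat_deriv:
  fixes f :: "real ^ 'n \<Rightarrow> complex"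
  assumes t: "t > 0" and f: "integrable lborel f"
  shows "partial_deriv i (convolve (heat_deriv \<gamma> t) f) = convolve (heat_deriv (\<gamma>(i := Suc (\<gamma> i))) t) f"
proof
  fix x :: "real ^ 'n"
  let ?\<delta> = "\<gamma>(i := Suc (\<gamma> i))" and ?e = "axis i 1 :: real ^ 'n"
  obtain B where B: "\<And>x. norm (heat_deriv ?\<delta> t (x :: real ^ 'n)) \<le> B"
    using heat_deriv_bounded by blast
  have [measurable]: "f \<in> borel_measurable borel"
    using borel_measurable_integrable[OF f] by simp
  \<comment> \<open>Mean value inequality along the line through \<open>z\<close> in direction
    \<open>i\<close>.\<close>
  have lip: "norm (heat_deriv \<gamma> t (z + s *\<^sub>R ?e) - heat_deriv \<gamma> t z) \<le> B * \<bar>s\<bar>" for z s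
  proof -
    have "norm (heat_deriv \<gamma> t (z + s *\<^sub>R ?e) - heat_deriv \<gamma> t (z + 0 *\<^sub>R ?e)) \<le> B * norm (s - 0)"
    proof (rule differentiable_bound[of UNIV "\<lambda>s. heat_deriv \<gamma> t (z + s *\<^sub>R ?e)"
          "\<lambda>s h. h *\<^sub>R heat_deriv ?\<delta> t (z + s *\<^sub>R ?e)"])
      show "((\<lambda>s. heat_deriv \<gamma> t (z + s *\<^sub>R ?e)) has_derivative (\<lambda>h. h *\<^sub>R heat_deriv ?\<delta> t (z + s *\<^sub>R ?e))) (at s)" for s
        using heat_deriv_has_vector_derivative[OF t] by (simp add: has_vector_derivative_def)
      show "onorm (\<lambda>h. h *\<^sub>R heat_deriv ?\<delta> t (z + s *\<^sub>R ?e)) \<le> B" for s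
        using B by (intro onorm_le) (simp add: mult.commute[of B] mult_left_mono)
    qed auto
    then show ?thesis by simp
  qed
  \<comment> \<open>The unsimplified \<open>x + 0 *\<^sub>R ?e\<close> is the value at s = 0 in the
    shape expected by \<open>has_vector_derivative_at_0_iff_quotient\<close>.\<close>
  have "((\<lambda>s. (convolve (heat_deriv \<gamma> t) f (x + s *\<^sub>R ?e) - convolve (heat_deriv \<gamma> t) f (x + 0 *\<^sub>R ?e)) /\<^sub>R s)
      \<longlongrightarrow> convolve (heat_deriv ?\<delta> t) f x) (at 0)"
    unfolding tendsto_at_iff_sequentially comp_def
  proof (intro allI impI)
    fix X :: "nat \<Rightarrow> real" assume X0: "\<forall>n. X n \<in> UNIV - {0}" and X: "X \<longlonglongrightarrow> 0"
    have *: "(convolve (heat_deriv \<gamma> t) f (x + X n *\<^sub>R ?e) - convolve (heat_deriv \<gamma> t) f (x + 0 *\<^sub>R ?e)) /\<^sub>R X n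
      = (LINT y|lborel. (heat_deriv \<gamma> t (x - y + X n *\<^sub>R ?e) - heat_deriv \<gamma> t (x - y)) /\<^sub>R X n * f y)" for n
    proof -
      have "convolve (heat_deriv \<gamma> t) f (x + X n *\<^sub>R ?e) - convolve (heat_deriv \<gamma> t) f x
        = (LINT y|lborel. (heat_deriv \<gamma> t (x + X n *\<^sub>R ?e - y) * f y - heat_deriv \<gamma> t (x - y) * f y))"
        unfolding convolve_def
        by (rule Bochner_Integration.integral_diff[symmetric]) (rule integrable_convolve_integrand[OF f])+
      then show ?thesis
        by (simp add: algebra_simps flip: integral_scaleR_right)
    qed
    show "(\<lambda>n. (convolve (heat_deriv \<gamma> t) f (x + X n *\<^sub>R ?e) - convolve (heat_deriv \<gamma> t) f (x + 0 *\<^sub>R ?e)) /\<^sub>R X n)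
        \<longlonglongrightarrow> convolve (heat_deriv ?\<delta> t) f x"
      unfolding * unfolding convolve_def
    proof (rule integral_dominated_convergence[where w="\<lambda>y. B * norm (f y)"])
      show "integrable lborel (\<lambda>y. B * norm (f y))" using f by simp
      show "AE y in lborel. (\<lambda>n. (heat_deriv \<gamma> t (x - y + X n *\<^sub>R ?e) - heat_deriv \<gamma> t (x - y)) /\<^sub>R X n * f y)
          \<longlonglongrightarrow> heat_deriv ?\<delta> t (x - y) * f y"
      proof (intro AE_I2 tendsto_mult tendsto_const)
        fix y
        have "((\<lambda>s. (heat_deriv \<gamma> t (x - y + s *\<^sub>R ?e) - heat_deriv \<gamma> t (x - y + 0 *\<^sub>R ?e)) /\<^sub>R s)
          \<longlongrightarrow> heat_deriv ?\<delta> t (x - y + 0 *\<^sub>R ?e)) (at 0)"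
          by (rule iffD1[OF has_vector_derivative_at_0_iff_quotient heat_deriv_has_vector_derivative[OF t]])
        then show "(\<lambda>n. (heat_deriv \<gamma> t (x - y + X n *\<^sub>R ?e) - heat_deriv \<gamma> t (x - y)) /\<^sub>R X n)
          \<longlonglongrightarrow> heat_deriv ?\<delta> t (x - y)"
          unfolding tendsto_at_iff_sequentially comp_def using X X0 by simp
      qed
      show "AE y in lborel. norm ((heat_deriv \<gamma> t (x - y + X n *\<^sub>R ?e) - heat_deriv \<gamma> t (x - y)) /\<^sub>R X n * f y)
          \<le> B * norm (f y)" for n
      proof (rule AE_I2)
        fix y
        have "norm ((heat_deriv \<gamma> t (x - y + X n *\<^sub>R ?e) - heat_deriv \<gamma> t (x - y)) /\<^sub>R X n) \<le> B"
          using lip[of "x - y" "X n"] X0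
          by (simp add: divide_inverse_commute[symmetric] pos_divide_le_eq)
        then show "norm ((heat_deriv \<gamma> t (x - y + X n *\<^sub>R ?e) - heat_deriv \<gamma> t (x - y)) /\<^sub>R X n * f y)
          \<le> B * norm (f y)"
          unfolding norm_mult by (rule mult_right_mono) simp
      qed
    qed measurable
  qed
  then have "((\<lambda>s. convolve (heat_deriv \<gamma> t) f (x + s *\<^sub>R ?e)) has_vector_derivative
      convolve (heat_deriv ?\<delta> t) f x) (at 0)"
    by (subst has_vector_derivative_at_0_iff_quotient)
  then show "partial_deriv i (convolve (heat_deriv \<gamma> t) f) x = convolve (heat_deriv ?\<delta> t) f x"
    unfolding partial_deriv_def by (rule vector_derivative_at)
qed

lemma partial_deriv_funpow_convolve_heat_deriv:
  fixes f :: "real ^ 'n \<Rightarrow> complex"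
  assumes t: "t > 0" and f: "integrable lborel f"
  shows "(partial_deriv i ^^ k) (convolve (heat_deriv \<gamma> t) f) = convolve (heat_deriv (\<gamma>(i := \<gamma> i + k)) t) f"
proof (induction k)
  case (Suc k)
  have "(\<gamma>(i := \<gamma> i + k))(i := Suc ((\<gamma>(i := \<gamma> i + k)) i)) = \<gamma>(i := \<gamma> i + Suc k)"
    by auto
  then show ?case
    using partial_deriv_convolve_heat_deriv[OF t f, of i "\<gamma>(i := \<gamma> i + k)"]
    by (simp only: funpow.simps comp_apply Suc)
qed simp

lemma multi_deriv_convolve_heat_kernel:
  fixes f :: "real ^ 'n::{finite,linorder} \<Rightarrow> complex"
  assumes t: "t > 0" and f: "integrable lborel f"
  shows "multi_deriv \<gamma> (convolve (heat_kernel t) f) = convolve (heat_deriv (($) \<gamma>) t) f"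
proof -
  \<comment> \<open>Generalised to lists of distinct indices for induction: a listed coordinate has
    received all its derivatives, any other none.\<close>
  have "foldr (\<lambda>i. partial_deriv i ^^ (\<gamma> $ i)) xs (convolve (heat_kernel t) f)
      = convolve (heat_deriv (\<lambda>i. if i \<in> set xs then \<gamma> $ i else 0) t) f" if "distinct xs" for xs
    using that
  proof (induction xs)
    case Nil
    show ?case using t by (simp add: heat_deriv_0)
  next
    case (Cons j xs)
    have "(\<lambda>i. if i \<in> set xs then \<gamma> $ i else 0)(j := (if j \<in> set xs then \<gamma> $ j else 0) + \<gamma> $ j)
      = (\<lambda>i. if i \<in> set (j # xs) then \<gamma> $ i else 0)"
      using Cons.prems by auto
    then show ?case
      using Cons by (simp add: partial_deriv_funpow_convolve_heat_deriv[OF t f])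
  qed
  from this[of "sorted_list_of_set UNIV"] show ?thesis
    by (simp add: multi_deriv_def)
qed

section \<open>The heat kernel as approximate identity, and Fourier uniqueness\<close>

lemma integrable_heat_kernel: "t > 0 \<Longrightarrow> integrable lborel (heat_kernel t :: real ^ 'n \<Rightarrow> complex)"
  using integrable_heat_deriv[of t "\<lambda>_. 0"] by (simp add: heat_deriv_0)

lemma measurable_heat_kernel [measurable]: "heat_kernel t \<in> borel_measurable borel"
  unfolding heat_kernel_def[abs_def] by measurable

text \<open>The total mass is the Fourier transform at 0; nonnegativity turns it into the
  norm.\<close>

lemma integral_heat_kernel:
  assumes "t > 0"
  shows "(LINT x|lborel. heat_kernel t (x :: real ^ 'n)) = 1"
    and "(LINT x|lborel. norm (heat_kernel t (x :: real ^ 'n))) = 1"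
proof -
  show 1: "(LINT x|lborel. heat_kernel t (x :: real ^ 'n)) = 1"
    using fourier_transform_heat_kernel[OF assms, of "0 :: real ^ 'n"]
    by (simp add: fourier_transform_lborel)
  have "heat_kernel t = (\<lambda>x. complex_of_real (norm (heat_kernel t (x :: real ^ 'n))))"
    by (simp add: heat_kernel_def norm_mult fun_eq_iff)
  from arg_cong[OF this, of "integral\<^sup>L lborel"]
  have "(LINT x|lborel. heat_kernel t (x :: real ^ 'n))
      = complex_of_real (LINT x|lborel. norm (heat_kernel t (x :: real ^ 'n)))"
    unfolding integral_complex_of_real .
  with 1 show "(LINT x|lborel. norm (heat_kernel t (x :: real ^ 'n))) = 1"
    by (metis of_real_eq_1_iff)
qed

text \<open>Writing the kernel as the Fourier transform of another Gaussian and applying Fubini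
  moves the transform onto \<open>f\<close>, where it vanishes.\<close>

lemma convolve_heat_kernel_eq_0:
  fixes f :: "real ^ 'n \<Rightarrow> complex"
  assumes t: "t > 0" and f: "integrable lborel f" and ft: "\<And>\<xi>. fourier_transform f \<xi> = 0"
  shows "convolve (heat_kernel t) f x = 0"
proof -
  \<comment> \<open>Chosen so that exp(-s |z|^2) is the exponential in the kernel at time
    \<open>t\<close>.\<close>
  define s where "s = 1 / (4 * t)"
  define c where "c = complex_of_real ((4 * pi * t) powr (- real CARD('n) / 2))"
  have s: "s > 0" using t by (simp add: s_def)
  have [measurable]: "f \<in> borel_measurable borel"
    using borel_measurable_integrable[OF f] by simp
  \<comment> \<open>a Gaussian is the Fourier transform of a Gaussian\<close>
  have G: "heat_kernel t z = c * (LINT w|lborel. exp (- \<i> * complex_of_real (w \<bullet> z)) * heat_kernel s w)" for z :: "real ^ 'n"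
  proof -
    have "heat_kernel t z = c * fourier_transform (heat_kernel s) z"
      unfolding fourier_transform_heat_kernel[OF s] by (simp add: heat_kernel_def c_def s_def)
    then show ?thesis by (simp add: fourier_transform_lborel)
  qed
  let ?F = "\<lambda>y w. exp (- \<i> * complex_of_real (w \<bullet> (x - y))) * heat_kernel s w * f y"
  have i: "integrable (lborel \<Otimes>\<^sub>M lborel) (\<lambda>(y, w). ?F y w)"
  proof (rule lborel_pair.Fubini_integrable)
    show "(\<lambda>(y, w). ?F y w) \<in> borel_measurable (lborel \<Otimes>\<^sub>M lborel)" by measurable
    show "integrable lborel (\<lambda>y. LINT w|lborel. norm (case (y, w) of (y, w) \<Rightarrow> ?F y w))"
      using f by (simp add: norm_mult)
    show "AE y in lborel. integrable lborel (\<lambda>w. case (y, w) of (y, w) \<Rightarrow> ?F y w)"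
      unfolding prod.case
      by (intro AE_I2 integrable_mult_left integrable_character_mult integrable_heat_kernel s)
  qed
  have "convolve (heat_kernel t) f x = c * (LINT y|lborel. LINT w|lborel. ?F y w)"
    unfolding convolve_def G by (simp only: integral_mult_left_zero integral_mult_right_zero mult.assoc[of c])
  also have "(LINT y|lborel. LINT w|lborel. ?F y w) = (LINT w|lborel. LINT y|lborel. ?F y w)"
    using lborel_pair.Fubini_integral[OF i] by simp
  also have "\<dots> = (LINT w|lborel. exp (- \<i> * complex_of_real (w \<bullet> x)) * heat_kernel s w * fourier_transform f (- w))"
  proof (intro Bochner_Integration.integral_cong refl)
    fix w
    have "?F y w = exp (- \<i> * complex_of_real (w \<bullet> x)) * heat_kernel s w * (exp (- \<i> * complex_of_real (y \<bullet> (- w))) * f y)" for y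
    proof -
      have "exp (- \<i> * complex_of_real (w \<bullet> (x - y))) = exp (- \<i> * complex_of_real (w \<bullet> x)) * exp (- \<i> * complex_of_real (y \<bullet> (- w)))"
        by (simp add: exp_add[symmetric] inner_diff_right inner_commute algebra_simps)
      then show ?thesis by (simp add: mult_ac)
    qed
    then have "(LINT y|lborel. ?F y w) = (LINT y|lborel. exp (- \<i> * complex_of_real (w \<bullet> x)) * heat_kernel s w *
        (exp (- \<i> * complex_of_real (y \<bullet> (- w))) * f y))"
      by (rule Bochner_Integration.integral_cong[OF refl])
    then show "(LINT y|lborel. ?F y w) = exp (- \<i> * complex_of_real (w \<bullet> x)) * heat_kernel s w * fourier_transform f (- w)"
      by (simp only: integral_mult_right_zero fourier_transform_lborel[OF \<open>f \<in> borel_measurable borel\<close>])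
  qed
  finally show ?thesis by (simp add: ft)
qed

text \<open>Serves to bound the kernel at time \<open>t\<close> by a multiple of the kernel at time
  2t, which leaves half of the Gaussian exponent free.\<close>

lemma heat_const_double:
  assumes "t > 0"
  shows "(4 * pi * t) powr (- r / 2) = 2 powr (r / 2) * (4 * pi * (2 * t)) powr (- r / 2)"
proof -
  have "(4 * pi * (2 * t)) powr (- r / 2) = 2 powr (- r / 2) * (4 * pi * t) powr (- r / 2)"
    using assms powr_mult[of 2 "4 * pi * t" "- r / 2"] by (simp add: mult_ac)
  then show ?thesis by (simp add: powr_minus)
qed

text \<open>The convolution of the heat kernel with \<open>f\<close> is zero at every time t > 0,
  yet it tends to f(x) as t tends to 0 by continuity at \<open>x\<close>. The function
  \<open>f\<close> may be unbounded, so far from \<open>x\<close> its two contributions are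
  estimated separately: f(y) by its L^1 norm, f(x) by the small mass of the kernel there.\<close>

lemma fourier_transform_eq_0_imp_eq_0:
  fixes f :: "real ^ 'n \<Rightarrow> complex"
  assumes f: "integrable lborel f" and c: "continuous_on UNIV f" and ft: "\<And>\<xi>. fourier_transform f \<xi> = 0"
  shows "f x = 0"
proof -
  define L where "L = (LINT y|lborel. norm (f y))"
  have "norm (f x) \<le> e" if e: "e > 0" for e
  proof -
    have "isCont f x" using c continuous_on_eq_continuous_at by blast
    then obtain d where d: "d > 0" "\<And>y. norm (x - y) < d \<Longrightarrow> norm (f y - f x) < e"
      using e unfolding continuous_at_eps_delta by (metis dist_norm norm_minus_commute)
    \<comment> \<open>The maximum of the kernel at distance at least \<open>d\<close>.\<close>
    define M where "M t = (4 * pi * t) powr (- real CARD('n) / 2) * exp (- d\<^sup>2 / (4 * t))" for t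
    \<comment> \<open>At distance at least \<open>d\<close> the kernel at time \<open>t\<close> is
      at most \<open>N t\<close> times the kernel at time 2t: half of the exponent is bounded by its
      value at \<open>d\<close>, the other half belongs to the wider kernel.\<close>
    define N where "N t = 2 powr (real CARD('n) / 2) * exp (- d\<^sup>2 / (8 * t))" for t
    have M: "(M \<longlongrightarrow> 0) (at_right 0)"
    proof -
      have "((\<lambda>t. (4 * pi * t) powr (- r / 2) * exp (- d\<^sup>2 / (4 * t))) \<longlongrightarrow> 0) (at_right 0)" if "r \<ge> 0" for r
        using d(1) that by real_asymp
      then show ?thesis unfolding M_def by simp
    qed
    have N: "(N \<longlongrightarrow> 0) (at_right 0)"
      unfolding N_def using d(1) by real_asymp
    have "norm (f x) \<le> e + M t * L + norm (f x) * N t" if t: "t > 0" for t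
    proof -
      let ?g = "\<lambda>s y. heat_kernel s (x - y)"
      have ig: "integrable lborel (?g s)" "(LINT y|lborel. ?g s y) = 1" "(LINT y|lborel. norm (?g s y)) = 1" if "s > 0" for s
        using lborel_integrable_reflect[OF integrable_heat_kernel[OF that], of x]
          lborel_integral_reflect[OF integrable_heat_kernel[OF that], of x]
          lborel_integral_reflect[OF integrable_norm[OF integrable_heat_kernel[OF that]], of x]
          integral_heat_kernel[OF that] by simp_all
      have i: "integrable lborel (\<lambda>y. ?g t y * f y)"
        using integrable_convolve_integrand[OF f, of "\<lambda>_. 0" t x] t by (simp add: heat_deriv_0)
      have "(LINT y|lborel. ?g t y * (f y - f x)) = (LINT y|lborel. ?g t y * f y) - (LINT y|lborel. ?g t y * f x)"
        using i ig(1)[OF t] by (subst Bochner_Integration.integral_diff[symmetric]) (auto simp: algebra_simps)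
      also have "\<dots> = - f x"
        using convolve_heat_kernel_eq_0[OF t f ft, of x] ig(2)[OF t] by (simp add: convolve_def)
      finally have "norm (f x) = norm (LINT y|lborel. ?g t y * (f y - f x))"
        by simp
      also have "\<dots> \<le> (LINT y|lborel. norm (?g t y * (f y - f x)))"
        by (rule integral_norm_bound)
      also have "\<dots> \<le> (LINT y|lborel. e * norm (?g t y) + M t * norm (f y) + norm (f x) * N t * norm (?g (2 * t) y))"
      proof (rule integral_mono)
        have "integrable lborel (\<lambda>y. ?g t y * f y - ?g t y * f x)"
          using i ig(1)[OF t] by auto
        then show "integrable lborel (\<lambda>y. norm (?g t y * (f y - f x)))"
          by (intro integrable_norm) (simp add: algebra_simps)
        show "integrable lborel (\<lambda>y. e * norm (?g t y) + M t * norm (f y) + norm (f x) * N t * norm (?g (2 * t) y))"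
          using f ig(1)[OF t] ig(1)[of "2 * t"] t by auto
        show "norm (?g t y * (f y - f x)) \<le> e * norm (?g t y) + M t * norm (f y) + norm (f x) * N t * norm (?g (2 * t) y)" for y
        proof (cases "norm (x - y) < d")
          case True
          then have "norm (?g t y * (f y - f x)) \<le> e * norm (?g t y)"
            using d(2)[of y] by (simp add: norm_mult mult.commute[of e] mult_left_mono)
          moreover have "M t * norm (f y) \<ge> 0" "norm (f x) * N t * norm (?g (2 * t) y) \<ge> 0"
            by (auto simp: M_def N_def)
          ultimately show ?thesis by linarith
        next
          case False
          then have q: "(norm (x - y))\<^sup>2 \<ge> d\<^sup>2" using d(1) by (intro power_mono) auto
          have g1: "norm (?g t y) \<le> M t"
            using q t by (simp add: heat_kernel_def M_def norm_mult divide_right_mono mult_left_mono)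
          have g2: "norm (?g t y) \<le> N t * norm (?g (2 * t) y)"
          proof -
            have e1: "exp (- (norm (x - y))\<^sup>2 / (4 * t)) \<le> exp (- d\<^sup>2 / (8 * t)) * exp (- (norm (x - y))\<^sup>2 / (8 * t))"
              unfolding exp_add[symmetric] using q t by (simp add: field_simps)
            have "norm (?g t y) = (4 * pi * t) powr (- real CARD('n) / 2) * exp (- (norm (x - y))\<^sup>2 / (4 * t))"
              by (simp add: heat_kernel_def norm_mult)
            also have "\<dots> \<le> (4 * pi * t) powr (- real CARD('n) / 2) * (exp (- d\<^sup>2 / (8 * t)) * exp (- (norm (x - y))\<^sup>2 / (8 * t)))"
              by (intro mult_left_mono e1) simp
            also have "\<dots> = N t * norm (?g (2 * t) y)"
              unfolding heat_const_double[OF t] by (simp add: heat_kernel_def norm_mult N_def)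
            finally show ?thesis .
          qed
          have "norm (?g t y * (f y - f x)) \<le> norm (?g t y) * (norm (f y) + norm (f x))"
            unfolding norm_mult by (intro mult_left_mono norm_triangle_ineq4) simp
          also have "\<dots> \<le> M t * norm (f y) + (N t * norm (?g (2 * t) y)) * norm (f x)"
            unfolding distrib_left by (intro add_mono mult_right_mono g1 g2) auto
          moreover have "e * norm (?g t y) \<ge> 0" using e by simp
          ultimately show ?thesis by (simp add: mult_ac)
        qed
      qed
      also have "\<dots> = e + M t * L + norm (f x) * N t"
        using f ig[OF t] ig[of "2 * t"] t by (simp add: L_def)
      finally show ?thesis .
    qed
    \<comment> \<open>Now t tends to 0 with \<open>e\<close> and \<open>d\<close> fixed.\<close>
    then have "\<forall>\<^sub>F t in at_right 0. norm (f x) \<le> e + M t * L + norm (f x) * N t"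
      by (simp add: eventually_at_filter)
    moreover have "((\<lambda>t. e + M t * L + norm (f x) * N t) \<longlongrightarrow> e + 0 * L + norm (f x) * 0) (at_right 0)"
      by (intro tendsto_intros M N)
    ultimately show ?thesis
      using tendsto_lowerbound[of "\<lambda>t. e + M t * L + norm (f x) * N t" e "at_right 0" "norm (f x)"] by simp
  qed
  then show ?thesis
    using field_le_epsilon[of "norm (f x)" 0] by auto
qed

lemma fourier_transform_inject:
  fixes f g :: "real ^ 'n \<Rightarrow> complex"
  assumes f: "integrable lborel f" "continuous_on UNIV f" and g: "integrable lborel g" "continuous_on UNIV g"
    and eq: "\<And>\<xi>. fourier_transform f \<xi> = fourier_transform g \<xi>"
  shows "f = g"
proof
  fix x
  have [measurable]: "f \<in> borel_measurable borel" "g \<in> borel_measurable borel"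
    using borel_measurable_continuous_onI f(2) g(2) by blast+
  have "fourier_transform (\<lambda>x. f x - g x) \<xi> = fourier_transform f \<xi> - fourier_transform g \<xi>" for \<xi>
    using integrable_character_mult[OF f(1), of \<xi>] integrable_character_mult[OF g(1), of \<xi>]
    by (simp add: fourier_transform_lborel right_diff_distrib)
  then have "f x - g x = 0"
    using fourier_transform_eq_0_imp_eq_0[of "\<lambda>x. f x - g x" x] eq f g
    by (simp add: continuous_on_diff)
  then show "f x = g x" by simp
qed

section \<open>The fractional heat kernel\<close>

text \<open>Two probability densities sharing a part of mass \<open>a\<close> are at L^1 distance at
  most 2(1 - a). The constant bound serves large \<open>s\<close> and the linear one small
  \<open>s\<close> in the integral against s^(-1-b).\<close>

lemma heat_kernel_diff_integral_le:
  assumes t: "t > 0" and s: "s > 0"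
  shows "(LINT x|lborel. norm (heat_kernel t x - heat_kernel (t + s) (x :: real ^ 'n))) \<le> 2"
    and "(LINT x|lborel. norm (heat_kernel t x - heat_kernel (t + s) (x :: real ^ 'n))) \<le> real CARD('n) / t * s"
proof -
  define a where "a = (t / (t + s)) powr (real CARD('n) / 2)"
  let ?g = "\<lambda>t x. norm (heat_kernel t (x :: real ^ 'n))"
  have a: "0 \<le> a" "a \<le> 1"
    unfolding a_def using t s by (auto intro!: powr_le1)
  \<comment> \<open>\<open>t\<^sup>n\<^sup>/\<^sup>2 G(x, t)\<close> is increasing in \<open>t\<close>, so \<open>a G(\<sqdot>, t)\<close> is a common part of both
    probability densities\<close>
  have le: "a * ?g t x \<le> ?g (t + s) x" for x
  proof -
    have "(4 * pi * (t + s)) powr (- real CARD('n) / 2) * (t / (t + s)) powr (- (real CARD('n) / 2))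
        = (4 * pi * t) powr (- real CARD('n) / 2)" (is "?X * _ = ?Y")
      using t s powr_mult[of "4 * pi * (t + s)" "t / (t + s)" "- real CARD('n) / 2"]
      by (simp add: mult.assoc)
    then have Y: "?X * inverse a = ?Y" by (simp only: powr_minus a_def)
    have "a > 0" using t s by (simp add: a_def)
    then have p: "a * ?Y = ?X" unfolding Y[symmetric] by simp
    have "a * ?g t x = (4 * pi * (t + s)) powr (- real CARD('n) / 2) * exp (- (norm x)\<^sup>2 / (4 * t))"
      unfolding p[symmetric] by (simp add: heat_kernel_def norm_mult)
    also have "\<dots> \<le> (4 * pi * (t + s)) powr (- real CARD('n) / 2) * exp (- (norm x)\<^sup>2 / (4 * (t + s)))"
      using t s by (intro mult_left_mono) (auto intro!: divide_left_mono)
    finally show ?thesis by (simp add: heat_kernel_def norm_mult)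
  qed
  have of_real: "heat_kernel t x = complex_of_real (?g t x)" for t and x :: "real ^ 'n"
    by (simp add: heat_kernel_def norm_mult)
  \<comment> \<open>Subtracting the common part from both densities leaves two nonnegative
    remainders, each of mass 1 - a.\<close>
  have "norm (heat_kernel t x - heat_kernel (t + s) x) \<le> (1 - a) * ?g t x + (?g (t + s) x - a * ?g t x)" for x :: "real ^ 'n"
  proof -
    have "norm (heat_kernel t x - heat_kernel (t + s) x) = \<bar>?g t x - ?g (t + s) x\<bar>"
      by (subst (1 2) of_real) (simp only: of_real_diff[symmetric] norm_of_real)
    also have "\<dots> = \<bar>(1 - a) * ?g t x - (?g (t + s) x - a * ?g t x)\<bar>" by (simp add: algebra_simps)
    also have "\<dots> \<le> \<bar>(1 - a) * ?g t x\<bar> + \<bar>?g (t + s) x - a * ?g t x\<bar>" by (rule abs_triangle_ineq4)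
    also have "\<dots> = (1 - a) * ?g t x + (?g (t + s) x - a * ?g t x)"
      using le[of x] a by simp
    finally show ?thesis .
  qed
  then have "(LINT x|lborel. norm (heat_kernel t x - heat_kernel (t + s) (x :: real ^ 'n)))
      \<le> (LINT x|lborel. (1 - a) * ?g t x + (?g (t + s) x - a * ?g t x))"
    using integrable_heat_kernel[OF t, where 'n='n] integrable_heat_kernel[of "t + s", where 'n='n] t s
    by (intro integral_mono) auto
  also have "\<dots> = 2 * (1 - a)"
    using integrable_heat_kernel[OF t, where 'n='n] integrable_heat_kernel[of "t + s", where 'n='n] t s integral_heat_kernel(2)[OF t, where 'n='n]
      integral_heat_kernel(2)[of "t + s", where 'n='n]
    by simp
  finally have I: "(LINT x|lborel. norm (heat_kernel t x - heat_kernel (t + s) (x :: real ^ 'n))) \<le> 2 * (1 - a)" .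
  then show "(LINT x|lborel. norm (heat_kernel t x - heat_kernel (t + s) (x :: real ^ 'n))) \<le> 2"
    using a by simp
  \<comment> \<open>From 1 - a \<le> -ln a = (n/2) ln(1 + s/t) \<le> (n/2) (s/t).\<close>
  have "2 * (1 - a) \<le> real CARD('n) / t * s"
  proof -
    have "ln ((t + s) / t) \<le> s / t"
      using ln_add_one_self_le_self[of "s / t"] t s by (simp add: field_simps)
    then have "real CARD('n) / 2 * ln ((t + s) / t) \<le> real CARD('n) / 2 * (s / t)"
      by (intro mult_left_mono) auto
    moreover have "a = exp (- (real CARD('n) / 2 * ln ((t + s) / t)))"
    proof -
      have "ln ((t + s) / t) = - ln (t / (t + s))" using t s by (simp add: ln_div)
      then show ?thesis using t s by (simp add: a_def powr_def)
    qed
    then have "a \<ge> 1 - real CARD('n) / 2 * ln ((t + s) / t)"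
      using exp_ge_add_one_self[of "- (real CARD('n) / 2 * ln ((t + s) / t))"] by simp
    ultimately have "1 - a \<le> real CARD('n) / 2 * (s / t)" by linarith
    then show ?thesis by (simp add: field_simps)
  qed
  with I show "(LINT x|lborel. norm (heat_kernel t x - heat_kernel (t + s) (x :: real ^ 'n))) \<le> real CARD('n) / t * s"
    by linarith
qed

text \<open>For \<open>0 < b < 1\<close> and \<open>r \<ge> 0\<close>, the power \<open>r\<^sup>b\<close> is a constant multiple of
  \<open>\<integral> (1 - e\<^sup>-\<^sup>r\<^sup>s) s\<^sup>-\<^sup>1\<^sup>-\<^sup>b ds\<close> over \<open>s > 0\<close>.\<close>

definition frac_weight :: "real \<Rightarrow> real \<Rightarrow> real" where
  "frac_weight b s = indicator {0<..} s * s powr (- 1 - b)"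

lemma frac_weight_nonneg: "frac_weight b s \<ge> 0"
  by (simp add: frac_weight_def)

lemma measurable_frac_weight [measurable]: "frac_weight b \<in> borel_measurable borel"
  unfolding frac_weight_def[abs_def] by measurable

text \<open>Near 0 the linear bound leaves s^(-b), integrable as b < 1; beyond 1 the constant bound
  leaves s^(-1-b), integrable as b > 0.\<close>

lemma integrable_frac_weight:
  fixes \<phi> :: "real \<Rightarrow> real"
  assumes b: "0 < b" "b < 1" and [measurable]: "\<phi> \<in> borel_measurable borel"
    and \<phi>: "\<And>s. s > 0 \<Longrightarrow> \<bar>\<phi> s\<bar> \<le> 2" "\<And>s. s > 0 \<Longrightarrow> \<bar>\<phi> s\<bar> \<le> c * s"
  shows "integrable lborel (\<lambda>s. frac_weight b s * \<phi> s)"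
proof -
  have "(\<lambda>s. s powr (- b)) absolutely_integrable_on {0..1}"
    using b integrable_on_powr_from_0[of "- b" 1] by (intro nonnegative_absolutely_integrable_1) auto
  then have 1: "integrable lborel (\<lambda>s. indicator {0..1} s * s powr (- b))"
    unfolding set_integrable_def by (subst (asm) integrable_completion) auto
  have "(\<lambda>s. s powr (- 1 - b)) absolutely_integrable_on {1..}"
    using b has_integral_powr_to_inf[of "- 1 - b" 1] by (intro nonnegative_absolutely_integrable_1) auto
  then have 2: "integrable lborel (\<lambda>s. indicator {1..} s * s powr (- 1 - b))"
    unfolding set_integrable_def by (subst (asm) integrable_completion) auto
  have c: "c \<ge> 0" using \<phi>(2)[of 1] by simp
  show ?thesis
  proof (rule Bochner_Integration.integrable_bound)
    show "integrable lborel (\<lambda>s. c * (indicator {0..1} s * s powr (- b)) + 2 * (indicator {1..} s * s powr (- 1 - b)))"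
      using 1 2 by auto
    show "AE s in lborel. norm (frac_weight b s * \<phi> s)
        \<le> norm (c * (indicator {0..1} s * s powr (- b)) + 2 * (indicator {1..} s * s powr (- 1 - b)))"
    proof (intro AE_I2)
      fix s :: real
      consider "s \<le> 0" | "0 < s" "s \<le> 1" | "s > 1" by linarith
      then show "norm (frac_weight b s * \<phi> s)
        \<le> norm (c * (indicator {0..1} s * s powr (- b)) + 2 * (indicator {1..} s * s powr (- 1 - b)))"
      proof cases
        case 1
        then show ?thesis by (simp add: frac_weight_def)
      next
        case 2
        have "norm (frac_weight b s * \<phi> s) \<le> s powr (- 1 - b) * (c * s)"
          using 2 \<phi>(2)[of s] by (simp add: frac_weight_def abs_mult mult_left_mono)
        also have "s powr (- 1 - b) * s = s powr (- b)"
          using 2 powr_add[of s "- 1 - b" 1] by simp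
        then have "s powr (- 1 - b) * (c * s) = c * s powr (- b)" by (simp add: mult_ac)
        also have "\<dots> \<le> norm (c * (indicator {0..1} s * s powr (- b)) + 2 * (indicator {1..} s * s powr (- 1 - b)))"
          using 2 c by (simp add: indicator_def)
        finally show ?thesis .
      next
        case 3
        have "norm (frac_weight b s * \<phi> s) \<le> s powr (- 1 - b) * 2"
          using 3 \<phi>(1)[of s] by (simp add: frac_weight_def abs_mult mult_left_mono)
        then show ?thesis using 3 by (simp add: indicator_def)
      qed
    qed
  qed measurable
qed

lemma integrable_frac_weight_exp:
  assumes b: "0 < b" "b < 1" and r: "r \<ge> 0"
  shows "integrable lborel (\<lambda>s. frac_weight b s * (1 - exp (- r * s)))"
proof (rule integrable_frac_weight[OF b, where c=r])
  fix s :: real assume s: "s > 0"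
  have "exp (- r * s) \<le> 1" using r s by simp
  then show "\<bar>1 - exp (- r * s)\<bar> \<le> 2" "\<bar>1 - exp (- r * s)\<bar> \<le> r * s"
    using exp_ge_add_one_self[of "- r * s"] less_imp_le[OF exp_gt_zero[of "- r * s"]]
    by linarith+
qed measurable

text \<open>For 0 < b < 1 this is Gamma(1 - b) / b. It is divided out at the end, so its positivity
  is what matters.\<close>

definition frac_const :: "real \<Rightarrow> real" where
  "frac_const b = (LINT s|lborel. frac_weight b s * (1 - exp (- s)))"

lemma frac_const_pos:
  assumes b: "0 < b" "b < 1"
  shows "frac_const b > 0"
proof -
  let ?f = "\<lambda>s. frac_weight b s * (1 - exp (- s))"
  have i: "integrable lborel ?f" using integrable_frac_weight_exp[OF b, of 1] by simp
  have nn: "?f s \<ge> 0" for s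
    by (simp add: frac_weight_def indicator_def)
  have "frac_const b \<noteq> 0"
  proof
    assume "frac_const b = 0"
    then have "AE s in lborel. ?f s = 0"
      using integral_nonneg_eq_0_iff_AE[OF i] nn by (simp add: frac_const_def)
    \<comment> \<open>The integrand is positive on (0,1), so its vanishing almost everywhere would
      make this interval null.\<close>
    then have "AE s in lborel. s \<notin> {0<..<1::real}"
      by eventually_elim (auto simp: frac_weight_def)
    then have "emeasure lborel {0<..<1::real} = 0"
      by (subst (asm) AE_iff_measurable[of "{0<..<1}"]) (auto simp del: emeasure_lborel_Ioo)
    then show False using emeasure_lborel_Ioo[of 0 1] by (simp del: emeasure_lborel_Ioo)
  qed
  moreover have "frac_const b \<ge> 0"
    unfolding frac_const_def by (intro integral_nonneg_AE AE_I2 nn)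
  ultimately show ?thesis by simp
qed

lemma integral_frac_weight_exp:
  assumes b: "0 < b" "b < 1" and r: "r \<ge> 0"
  shows "(LINT s|lborel. frac_weight b s * (1 - exp (- r * s))) = r powr b * frac_const b"
proof (cases "r = 0")
  case False
  with r have r: "r > 0" by simp
  \<comment> \<open>Substituting s = u/r: the weight is homogeneous of degree -1-b, and the Jacobian
    1/r reduces r^(1+b) to r^b.\<close>
  have "frac_weight b (0 + 1 / r * u) = r powr (1 + b) * frac_weight b u" for u
    using r by (auto simp: frac_weight_def indicator_def powr_divide zero_less_divide_iff powr_minus powr_diff powr_add field_simps)
  then have "(LINT s|lborel. frac_weight b s * (1 - exp (- r * s)))
     = 1 / r * (LINT u|lborel. r powr (1 + b) * (frac_weight b u * (1 - exp (- u))))"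
    using r by (subst lborel_integral_real_affine[of "1 / r" _ 0]) (auto simp: mult_ac)
  also have "\<dots> = 1 / r * r powr (1 + b) * frac_const b"
    by (simp add: frac_const_def)
  also have "1 / r * r powr (1 + b) = r powr b"
    using r by (simp add: powr_add)
  finally show ?thesis .
qed (use b in simp)

text \<open>The transform of the difference of the kernels at times t and t + s is exp(-t|\<xi>|^2)
  (1 - exp(-s|\<xi>|^2)). Integrating it against the weight with b = \<beta>/2 yields a multiple of
  (|\<xi>|^2)^b exp(-t|\<xi>|^2).\<close>

lemma riesz_heat_kernel_exists_less_2:
  assumes \<beta>: "0 < \<beta>" "\<beta> < 2" and t: "t > 0"
  shows "\<exists>k :: real ^ 'n \<Rightarrow> complex. integrable lborel k \<and>
    (\<forall>\<xi>. fourier_transform k \<xi> = complex_of_real (norm \<xi> powr \<beta> * exp (- t * (norm \<xi>)\<^sup>2)))"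
proof -
  define b where "b = \<beta> / 2"
  have b: "0 < b" "b < 1" using \<beta> by (auto simp: b_def)
  define F where "F s x = complex_of_real (frac_weight b s) * (heat_kernel t x - heat_kernel (t + s) (x :: real ^ 'n))" for s x
  define K where "K x = (LINT s|lborel. F s x)" for x
  have [measurable]: "(\<lambda>(s, x). heat_kernel (t + s) (x :: real ^ 'n)) \<in> borel_measurable (borel \<Otimes>\<^sub>M borel)"
    unfolding heat_kernel_def by measurable
  have [measurable]: "(\<lambda>(s, x). F s x) \<in> borel_measurable (lborel \<Otimes>\<^sub>M lborel)"
    unfolding F_def by measurable
  have iG: "integrable lborel (\<lambda>x. heat_kernel t x - heat_kernel (t + s) (x :: real ^ 'n))" if "s > 0" for s
    using integrable_heat_kernel[OF t] integrable_heat_kernel[of "t + s"] t that by auto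
  have iF: "integrable lborel (F s)" for s
    using iG[of s] by (cases "s > 0") (auto simp: F_def[abs_def] frac_weight_def)
  have i: "integrable (lborel \<Otimes>\<^sub>M lborel) (\<lambda>(s, x). F s x)"
  proof (rule lborel_pair.Fubini_integrable)
    let ?\<phi> = "\<lambda>s. (LINT x|lborel. norm (heat_kernel t x - heat_kernel (t + s) (x :: real ^ 'n)))"
    have "integrable lborel (\<lambda>s. frac_weight b s * ?\<phi> s)"
      using heat_kernel_diff_integral_le[OF t, where 'n='n]
      by (intro integrable_frac_weight[OF b, where c="real CARD('n) / t"]) auto
    then show "integrable lborel (\<lambda>s. LINT x|lborel. norm (case (s, x) of (s, x) \<Rightarrow> F s x))"
      by (simp add: F_def norm_mult frac_weight_nonneg)
    show "AE s in lborel. integrable lborel (\<lambda>x. case (s, x) of (s, x) \<Rightarrow> F s x)"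
      using iF by simp
  qed measurable
  have K: "integrable lborel K"
    unfolding K_def using lborel_pair.integrable_snd[OF i] by simp
  have [measurable]: "K \<in> borel_measurable borel"
    using borel_measurable_integrable[OF K] by simp
  have "fourier_transform K \<xi> = complex_of_real (frac_const b * (norm \<xi> powr \<beta> * exp (- t * (norm \<xi>)\<^sup>2)))" for \<xi>
  proof -
    let ?e = "\<lambda>x. exp (- \<i> * complex_of_real (x \<bullet> \<xi>))" and ?r = "(norm \<xi>)\<^sup>2"
    have ie: "integrable (lborel \<Otimes>\<^sub>M lborel) (\<lambda>(s, x). ?e x * F s x)"
      by (rule Bochner_Integration.integrable_bound[OF i]) (auto simp: norm_mult)
    have "fourier_transform K \<xi> = (LINT x|lborel. LINT s|lborel. ?e x * F s x)"
      by (simp add: fourier_transform_lborel K_def)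
    also have "\<dots> = (LINT s|lborel. LINT x|lborel. ?e x * F s x)"
      using lborel_pair.Fubini_integral[OF ie] by simp
    also have "\<dots> = (LINT s|lborel. complex_of_real (exp (- t * ?r) * (frac_weight b s * (1 - exp (- ?r * s)))))"
    proof (intro Bochner_Integration.integral_cong refl)
      fix s
      show "(LINT x|lborel. ?e x * F s x) = complex_of_real (exp (- t * ?r) * (frac_weight b s * (1 - exp (- ?r * s))))"
      proof (cases "s > 0")
        case True
        then have ts: "t + s > 0" using t by simp
        have "(LINT x|lborel. ?e x * F s x) = complex_of_real (frac_weight b s) *
            (LINT x|lborel. ?e x * heat_kernel t x - ?e x * heat_kernel (t + s) x)"
          unfolding F_def by (subst integral_mult_right_zero[symmetric]) (simp add: algebra_simps)
        also have "(LINT x|lborel. ?e x * heat_kernel t x - ?e x * heat_kernel (t + s) x)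
            = fourier_transform (heat_kernel t) \<xi> - fourier_transform (heat_kernel (t + s)) \<xi>"
          using integrable_character_mult[OF integrable_heat_kernel[OF t], of \<xi>]
            integrable_character_mult[OF integrable_heat_kernel[OF ts], of \<xi>]
          by (simp add: fourier_transform_lborel)
        also have "\<dots> = complex_of_real (exp (- t * ?r) * (1 - exp (- ?r * s)))"
          unfolding fourier_transform_heat_kernel[OF t] fourier_transform_heat_kernel[OF ts]
          unfolding of_real_diff[symmetric]
          by (rule arg_cong[of _ _ complex_of_real]) (simp add: right_diff_distrib flip: exp_add, simp add: algebra_simps)
        finally show ?thesis by simp
      qed (simp add: F_def frac_weight_def)
    qed
    also have "\<dots> = complex_of_real (exp (- t * ?r) * (?r powr b * frac_const b))"
      unfolding integral_complex_of_real integral_mult_right_zero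
      by (subst integral_frac_weight_exp[OF b]) auto
    also have "?r powr b = norm \<xi> powr \<beta>"
      using powr_powr[of "norm \<xi>" 2 b] by (cases "\<xi> = 0") (simp_all add: b_def)
    finally show ?thesis by (simp add: mult_ac)
  qed
  then have "fourier_transform (\<lambda>x. K x / complex_of_real (frac_const b)) \<xi>
      = complex_of_real (norm \<xi> powr \<beta> * exp (- t * (norm \<xi>)\<^sup>2))" for \<xi>
    using frac_const_pos[OF b] by (simp add: fourier_transform_lborel)
  then show ?thesis using K by (intro exI[of _ "\<lambda>x. K x / complex_of_real (frac_const b)"]) auto
qed

text \<open>A kernel for order \<beta>/2 and time t/2 convolved with itself is one for \<beta> and
  t, and repeated halving brings the order below 2.\<close>

lemma riesz_heat_kernel_exists:
  assumes \<beta>: "0 < \<beta>" and t: "t > 0"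
  shows "\<exists>k :: real ^ 'n \<Rightarrow> complex. integrable lborel k \<and>
    (\<forall>\<xi>. fourier_transform k \<xi> = complex_of_real (norm \<xi> powr \<beta> * exp (- t * (norm \<xi>)\<^sup>2)))"
proof -
  obtain m :: nat where "\<beta> < 2 ^ m"
    using real_arch_pow[of 2 \<beta>] by auto
  \<comment> \<open>With \<open>Suc m\<close> the base case m = 0 reads \<beta> < 2.\<close>
  then have "\<beta> < 2 ^ Suc m"
    by (rule less_le_trans) simp
  then show ?thesis using \<beta> t
  proof (induction m arbitrary: \<beta> t)
    case 0
    then show ?case using riesz_heat_kernel_exists_less_2 by simp
  next
    case (Suc m)
    obtain k :: "real ^ 'n \<Rightarrow> complex" where k: "integrable lborel k"
      "\<And>\<xi>. fourier_transform k \<xi> = complex_of_real (norm \<xi> powr (\<beta> / 2) * exp (- (t / 2) * (norm \<xi>)\<^sup>2))"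
      using Suc.IH[of "\<beta> / 2" "t / 2"] Suc.prems by auto
    have "fourier_transform (convolve k k) \<xi> = complex_of_real (norm \<xi> powr \<beta> * exp (- t * (norm \<xi>)\<^sup>2))" for \<xi>
    proof -
      have "norm \<xi> powr (\<beta> / 2) * norm \<xi> powr (\<beta> / 2) = norm \<xi> powr \<beta>"
        by (simp flip: powr_add)
      moreover have "exp (- (t / 2) * (norm \<xi>)\<^sup>2) * exp (- (t / 2) * (norm \<xi>)\<^sup>2) = exp (- t * (norm \<xi>)\<^sup>2)"
        by (simp flip: exp_add)
      moreover have "(p * q) * (p * q) = (p * p) * (q * q)" for p q :: real
        by (simp only: mult_ac)
      ultimately show ?thesis
        unfolding fourier_transform_convolve[OF k(1) k(1)] k(2) of_real_mult[symmetric] by presburger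
    qed
    then show ?case using integrable_convolve[OF k(1) k(1)] by blast
  qed
qed

section \<open>Large dilations\<close>

lemma isCont_heat_kernel_translate:
  assumes s: "s > 0"
  shows "isCont (\<lambda>h. LINT x|lborel. norm (heat_kernel s (x - h) - heat_kernel s (x :: real ^ 'n))) 0"
  unfolding continuous_at_sequentially comp_def
proof (intro allI impI)
  fix X :: "nat \<Rightarrow> real ^ 'n" assume X: "X \<longlonglongrightarrow> 0"
  obtain B where B: "\<And>n. norm (X n) \<le> B"
    using convergent_imp_Bseq[OF convergentI[OF X]] unfolding Bseq_def by blast
  \<comment> \<open>From |x|^2 \<le> 2|x - h|^2 + 2B^2 for |h| \<le> B: all translates of the kernel
    along the sequence lie below \<open>D\<close> times the kernel at time 2s, an integrable
    majorant.\<close>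
  define D where "D = 2 powr (real CARD('n) / 2) * exp (B\<^sup>2 / (4 * s))"
  have "continuous_on UNIV (heat_kernel s :: real ^ 'n \<Rightarrow> complex)"
    using continuous_heat_deriv[of "\<lambda>_::'n. 0" s] s by (simp add: heat_deriv_0)
  then have c: "isCont (heat_kernel s) z" for z :: "real ^ 'n"
    by (simp add: continuous_on_eq_continuous_at)
  have le: "norm (heat_kernel s (x - X n)) \<le> D * norm (heat_kernel (2 * s) x)" for n x
  proof -
    have "(norm x)\<^sup>2 \<le> (norm (x - X n) + norm (X n))\<^sup>2"
      using norm_triangle_ineq[of "x - X n" "X n"] by (intro power_mono) auto
    also have "\<dots> \<le> 2 * (norm (x - X n))\<^sup>2 + 2 * (norm (X n))\<^sup>2"
      using sum_squares_bound[of "norm (x - X n)" "norm (X n)"] by (simp add: power2_sum)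
    also have "\<dots> \<le> 2 * (norm (x - X n))\<^sup>2 + 2 * B\<^sup>2"
      using B[of n] by (simp add: power_mono)
    finally have e1: "exp (- (norm (x - X n))\<^sup>2 / (4 * s)) \<le> exp (B\<^sup>2 / (4 * s)) * exp (- (norm x)\<^sup>2 / (8 * s))"
      unfolding exp_add[symmetric] using s by (simp add: field_simps)
    have "norm (heat_kernel s (x - X n)) = (4 * pi * s) powr (- real CARD('n) / 2) * exp (- (norm (x - X n))\<^sup>2 / (4 * s))"
      by (simp add: heat_kernel_def norm_mult)
    also have "\<dots> \<le> (4 * pi * s) powr (- real CARD('n) / 2) * (exp (B\<^sup>2 / (4 * s)) * exp (- (norm x)\<^sup>2 / (8 * s)))"
      by (intro mult_left_mono e1) simp
    also have "\<dots> = D * norm (heat_kernel (2 * s) x)"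
      unfolding heat_const_double[OF s] by (simp add: heat_kernel_def norm_mult D_def)
    finally show ?thesis .
  qed
  show "(\<lambda>n. LINT x|lborel. norm (heat_kernel s (x - X n) - heat_kernel s x))
    \<longlonglongrightarrow> (LINT x|lborel. norm (heat_kernel s (x - 0) - heat_kernel s (x :: real ^ 'n)))"
  proof (rule integral_dominated_convergence[where w="\<lambda>x. D * norm (heat_kernel (2 * s) x) + norm (heat_kernel s x)"])
    show "integrable lborel (\<lambda>x. D * norm (heat_kernel (2 * s) x) + norm (heat_kernel s (x :: real ^ 'n)))"
      using integrable_heat_kernel[OF s, where 'n='n] integrable_heat_kernel[of "2 * s", where 'n='n] s by auto
    show "AE x in lborel. (\<lambda>n. norm (heat_kernel s (x - X n) - heat_kernel s x))
        \<longlonglongrightarrow> norm (heat_kernel s (x - 0) - heat_kernel s x)"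
      by (intro AE_I2 tendsto_intros isCont_tendsto_compose[OF c] X)
    show "AE x in lborel. norm (norm (heat_kernel s (x - X n) - heat_kernel s x))
        \<le> D * norm (heat_kernel (2 * s) x) + norm (heat_kernel s x)" for n
      using le[of _ n] by (intro AE_I2) (simp, meson add_right_mono norm_triangle_ineq4 order_trans)
  qed measurable
qed

text \<open>Translation commutes with convolution, so by Young's inequality the L^1 modulus of
  continuity is at most that of the heat kernel times the norm of \<open>k\<close>.\<close>

lemma isCont_convolve_heat_kernel_translate:
  fixes k :: "real ^ 'n \<Rightarrow> complex"
  assumes s: "s > 0" and k: "integrable lborel k"
  shows "isCont (\<lambda>h. LINT x|lborel. norm (convolve (heat_kernel s) k (x - h) - convolve (heat_kernel s) k x)) 0"
proof -
  let ?\<omega> = "\<lambda>h. LINT x|lborel. norm (heat_kernel s (x - h) - heat_kernel s (x :: real ^ 'n))"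
  let ?L = "LINT x|lborel. norm (k x)"
  have eq: "convolve (heat_kernel s) k (x - h) - convolve (heat_kernel s) k x
    = convolve (\<lambda>x. heat_kernel s (x - h) - heat_kernel s x) k x" for x h
  proof -
    have i: "integrable lborel (\<lambda>y. heat_kernel s (x - y) * k y)" for x
      using integrable_convolve_integrand[OF k, of "\<lambda>_. 0" s x] s by (simp add: heat_deriv_0)
    show ?thesis
      unfolding convolve_def using Bochner_Integration.integral_diff[OF i[of "x - h"] i[of x]]
      by (simp add: left_diff_distrib algebra_simps)
  qed
  have le: "(LINT x|lborel. norm (convolve (heat_kernel s) k (x - h) - convolve (heat_kernel s) k x)) \<le> ?\<omega> h * ?L" for h
    unfolding eq
    using lborel_integrable_translate[OF integrable_heat_kernel[OF s]] integrable_heat_kernel[OF s] k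
    by (intro norm_convolve_le Bochner_Integration.integrable_diff)
  have "(?\<omega> \<longlongrightarrow> 0) (at 0)"
    using isCont_heat_kernel_translate[OF s, where 'n='n] by (simp add: isCont_def)
  then have "((\<lambda>h. ?\<omega> h * ?L) \<longlongrightarrow> 0) (at 0)"
    by (rule tendsto_mult_left_zero)
  from tendsto_sandwich[OF _ _ tendsto_const this, OF always_eventually always_eventually]
  have "((\<lambda>h. LINT x|lborel. norm (convolve (heat_kernel s) k (x - h) - convolve (heat_kernel s) k x)) \<longlongrightarrow> 0) (at 0)"
    using le by simp
  then show ?thesis by (simp add: isCont_def)
qed

text \<open>With \<omega> the L^1 modulus of continuity of \<open>K\<close>, the norm is at most the
  integral of |v(y)| \<omega>(y / sqrt s). As s grows, \<omega>(y / sqrt s) tends to 0 for each y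
  and stays below twice the norm of \<open>K\<close>, so dominated convergence applies.\<close>

lemma convolve_dilate_tendsto:
  fixes K v :: "real ^ 'n \<Rightarrow> complex"
  assumes K: "integrable lborel K" and v: "integrable lborel v"
    and tr: "isCont (\<lambda>h. LINT x|lborel. norm (K (x - h) - K x)) 0"
  shows "((\<lambda>s. LINT x|lborel. norm (convolve (dilate s K) v x - (LINT y|lborel. v y) * dilate s K x)) \<longlongrightarrow> 0) at_top"
proof -
  let ?\<omega> = "\<lambda>h. LINT x|lborel. norm (K (x - h) - K x)"
  have [measurable]: "K \<in> borel_measurable borel" "v \<in> borel_measurable borel"
    using borel_measurable_integrable[OF K] borel_measurable_integrable[OF v] by simp_all
  have \<omega>_le: "?\<omega> h \<le> 2 * (LINT x|lborel. norm (K x))" for h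
  proof -
    have "?\<omega> h \<le> (LINT x|lborel. norm (K (x - h)) + norm (K x))"
      using K lborel_integrable_translate[OF K, of h]
      by (intro integral_mono) (auto intro: norm_triangle_ineq4)
    also have "\<dots> = 2 * (LINT x|lborel. norm (K x))"
      using K lborel_integrable_translate[OF K, of h] lborel_integral_translate[OF integrable_norm[OF K], of h] by simp
    finally show ?thesis .
  qed
  have "((\<lambda>s. LINT y|lborel. norm (v y) * ?\<omega> (y /\<^sub>R sqrt s)) \<longlongrightarrow> (LINT y|(lborel :: (real ^ 'n) measure). 0)) at_top"
  proof (rule integral_dominated_convergence_at_top)
    show "integrable lborel (\<lambda>y. norm (v y) * (2 * (LINT x|lborel. norm (K x))))" using v by simp
    show "\<forall>\<^sub>F s in at_top. AE y in lborel. norm (norm (v y) * ?\<omega> (y /\<^sub>R sqrt s)) \<le> norm (v y) * (2 * (LINT x|lborel. norm (K x)))"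
      using \<omega>_le by (intro always_eventually allI AE_I2) (simp add: abs_mult mult_left_mono)
    show "AE y in lborel. ((\<lambda>s. norm (v y) * ?\<omega> (y /\<^sub>R sqrt s)) \<longlongrightarrow> 0) at_top"
    proof (rule AE_I2)
      fix y :: "real ^ 'n"
      have "((\<lambda>s. inverse (sqrt s)) \<longlongrightarrow> 0) at_top"
        using tendsto_inverse_0_at_top[OF sqrt_at_top] .
      then have "((\<lambda>s. y /\<^sub>R sqrt s) \<longlongrightarrow> 0) at_top"
        using tendsto_scaleR[of "\<lambda>s. inverse (sqrt s)" 0 at_top "\<lambda>_. y" y] by simp
      from isCont_tendsto_compose[OF tr this]
      have "((\<lambda>s. ?\<omega> (y /\<^sub>R sqrt s)) \<longlongrightarrow> 0) at_top" by simp
      then show "((\<lambda>s. norm (v y) * ?\<omega> (y /\<^sub>R sqrt s)) \<longlongrightarrow> 0) at_top"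
        by (rule tendsto_mult_right_zero)
    qed
  qed measurable
  then have lim: "((\<lambda>s. LINT y|lborel. norm (v y) * ?\<omega> (y /\<^sub>R sqrt s)) \<longlongrightarrow> 0) at_top" by simp
  have "(LINT x|lborel. norm (convolve (dilate s K) v x - (LINT y|lborel. v y) * dilate s K x))
      \<le> (LINT y|lborel. norm (v y) * ?\<omega> (y /\<^sub>R sqrt s))" if s: "s > 0" for s
  proof -
    let ?d = "dilate s K"
    have d: "integrable lborel ?d" by (rule integrable_dilate[OF K s])
    have [measurable]: "?d \<in> borel_measurable borel"
      using borel_measurable_integrable[OF d] by simp
    have p2: "integrable (lborel \<Otimes>\<^sub>M lborel) (\<lambda>(y, x). ?d x * v y)"
    proof (rule lborel_pair.Fubini_integrable)
      show "integrable lborel (\<lambda>y. LINT x|lborel. norm (case (y, x) of (y, x) \<Rightarrow> ?d x * v y))"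
        using v by (simp add: norm_mult)
      show "AE y in lborel. integrable lborel (\<lambda>x. case (y, x) of (y, x) \<Rightarrow> ?d x * v y)"
        using d by simp
    qed measurable
    have p: "integrable (lborel \<Otimes>\<^sub>M lborel) (\<lambda>(y, x). (?d (x - y) - ?d x) * v y)"
      using Bochner_Integration.integrable_diff[OF convolve_pair_integrable[OF d v] p2]
      by (simp add: case_prod_unfold left_diff_distrib)
    then have pn: "integrable (lborel \<Otimes>\<^sub>M lborel) (\<lambda>(y, x). norm ((?d (x - y) - ?d x) * v y))"
      using integrable_norm by (fastforce simp: case_prod_unfold)
    \<comment> \<open>Only almost everywhere: splitting the integral needs the convolution to
      converge at \<open>x\<close>.\<close>
    have ae: "AE x in lborel. convolve ?d v x - (LINT y|lborel. v y) * ?d x = (LINT y|lborel. (?d (x - y) - ?d x) * v y)"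
      using lborel_pair.AE_integrable_snd[OF convolve_pair_integrable[OF d v]]
    proof eventually_elim
      case (elim x)
      have "(LINT y|lborel. (?d (x - y) - ?d x) * v y) = (LINT y|lborel. ?d (x - y) * v y - ?d x * v y)"
        by (simp add: left_diff_distrib)
      also have "\<dots> = convolve ?d v x - (LINT y|lborel. v y) * ?d x"
        using elim v by (simp add: convolve_def mult.commute)
      finally show ?case by simp
    qed
    have "(LINT x|lborel. norm (convolve ?d v x - (LINT y|lborel. v y) * ?d x))
        = (LINT x|lborel. norm (LINT y|lborel. (?d (x - y) - ?d x) * v y))"
      by (rule integral_cong_AE) (use ae in auto)
    also have "\<dots> \<le> (LINT x|lborel. (LINT y|lborel. norm ((?d (x - y) - ?d x) * v y)))"
      using integrable_norm[OF lborel_pair.integrable_snd[OF p]] lborel_pair.integrable_snd[OF pn]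
      by (intro integral_mono integral_norm_bound) simp_all
    also have "\<dots> = (LINT y|lborel. (LINT x|lborel. norm ((?d (x - y) - ?d x) * v y)))"
      using lborel_pair.Fubini_integral[OF pn] by simp
    also have "\<dots> = (LINT y|lborel. norm (v y) * ?\<omega> (y /\<^sub>R sqrt s))"
    proof (intro Bochner_Integration.integral_cong refl)
      fix y
      let ?K = "\<lambda>x. K (x - y /\<^sub>R sqrt s) - K x"
      \<comment> \<open>Translating the dilated kernel by y amounts to dilating the kernel
        translated by y / sqrt s, and dilation preserves the norm.\<close>
      have "?d (x - y) - ?d x = dilate s ?K x" for x
        by (simp add: dilate_def right_diff_distrib scaleR_diff_right)
      then have "(LINT x|lborel. norm ((?d (x - y) - ?d x) * v y)) = norm (v y) * (LINT x|lborel. norm (dilate s ?K x))"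
        by (simp add: norm_mult mult.commute)
      also have "(LINT x|lborel. norm (dilate s ?K x)) = ?\<omega> (y /\<^sub>R sqrt s)"
        by (rule integral_norm_dilate[OF _ s]) (use K lborel_integrable_translate[OF K] in auto)
      finally show "(LINT x|lborel. norm ((?d (x - y) - ?d x) * v y)) = norm (v y) * ?\<omega> (y /\<^sub>R sqrt s)" .
    qed
    finally show ?thesis .
  qed
  then have "\<forall>\<^sub>F s in at_top. (LINT x|lborel. norm (convolve (dilate s K) v x - (LINT y|lborel. v y) * dilate s K x))
      \<le> (LINT y|lborel. norm (v y) * ?\<omega> (y /\<^sub>R sqrt s))"
    using eventually_gt_at_top[of 0] by (rule eventually_mono[rotated]) blast
  then show ?thesis
    by (intro tendsto_sandwich[OF _ _ tendsto_const lim]) (auto intro!: always_eventually)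
qed

section \<open>Borel representatives of Lebesgue integrable functions\<close>

lemma lebesgue_integrable_borel_representative:
  fixes u :: "real ^ 'n \<Rightarrow> complex"
  assumes u: "integrable lebesgue u"
  obtains u' where "integrable lborel u'" "AE x in lebesgue. u x = u' x"
proof -
  have um: "u \<in> borel_measurable lebesgue" using u by (rule borel_measurable_integrable)
  have "(\<lambda>x. Re (u x)) \<in> borel_measurable lebesgue" "(\<lambda>x. Im (u x)) \<in> borel_measurable lebesgue"
    using um by measurable
  from this[THEN completion_ex_borel_measurable_real]
  obtain a b where ab[measurable]: "a \<in> borel_measurable lborel" "b \<in> borel_measurable lborel"
    and ae: "AE x in lborel. Re (u x) = a x" "AE x in lborel. Im (u x) = b x" by blast
  define u' where "u' x = Complex (a x) (b x)" for x
  have [measurable]: "u' \<in> borel_measurable lborel"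
    unfolding u'_def[abs_def] Complex_eq by measurable
  have "AE x in lborel. u x = u' x"
    using ae by eventually_elim (simp add: u'_def complex_eq_iff)
  then have AE: "AE x in lebesgue. u x = u' x" by (rule AE_completion)
  have "integrable lebesgue u'"
    using u AE by (subst integrable_cong_AE[of _ _ u]) (auto simp: um measurable_completion)
  then have "integrable lborel u'" by (subst (asm) integrable_completion) auto
  with AE that show ?thesis by blast
qed

lemma l1_norm_lborel:
  assumes [measurable]: "f \<in> borel_measurable borel"
  shows "l1_norm f = (LINT x|lborel. norm (f x))"
  unfolding l1_norm_def by (rule integral_completion) measurable

lemma integrable_lebesgue_iff_lborel:
  fixes f :: "real ^ 'n \<Rightarrow> complex"
  assumes [measurable]: "f \<in> borel_measurable borel"
  shows "integrable lebesgue f \<longleftrightarrow> integrable lborel f"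
  by (rule integrable_completion) measurable

lemma
  fixes u u' :: "real ^ 'n \<Rightarrow> complex"
  assumes u: "integrable lebesgue u" and u': "integrable lborel u'" and AE: "AE x in lebesgue. u x = u' x"
  shows fourier_transform_cong_lborel: "fourier_transform u = fourier_transform u'"
    and heat_semigroup_eq_convolve: "heat_semigroup t u = convolve (heat_kernel t) u'"
    and l1_norm_cong_lborel: "l1_norm u = (LINT x|lborel. norm (u' x))"
    and integral_cong_lborel: "(LINT x|lebesgue. u x) = (LINT x|lborel. u' x)"
proof -
  have um [measurable]: "u \<in> borel_measurable lebesgue" using u by (rule borel_measurable_integrable)
  have u'm [measurable]: "u' \<in> borel_measurable borel" using borel_measurable_integrable[OF u'] by simp
  have u'l [measurable]: "u' \<in> borel_measurable lebesgue" by (simp add: measurable_completion)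
  \<comment> \<open>One form for three integrals: \<open>g\<close> is a character, a translated and
    reflected heat kernel, or the constant 1.\<close>
  have eq: "(LINT x|lebesgue. g x * u x) = (LINT x|lborel. g x * u' x)"
    if [measurable]: "g \<in> borel_measurable borel" for g :: "real ^ 'n \<Rightarrow> complex"
  proof -
    have [measurable]: "g \<in> borel_measurable lebesgue" by (simp add: measurable_completion)
    have "(LINT x|lebesgue. g x * u x) = (LINT x|lebesgue. g x * u' x)"
      using AE by (intro integral_cong_AE) auto
    also have "\<dots> = (LINT x|lborel. g x * u' x)" by (rule integral_completion) measurable
    finally show ?thesis .
  qed
  show "fourier_transform u = fourier_transform u'"
    by (rule ext, subst fourier_transform_lborel) (simp_all add: fourier_transform_def eq)
  show "heat_semigroup t u = convolve (heat_kernel t) u'"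
    by (rule ext) (simp add: heat_semigroup_def convolve_def eq)
  show "(LINT x|lebesgue. u x) = (LINT x|lborel. u' x)"
    using eq[of "\<lambda>_. 1"] by simp
  have "l1_norm u = l1_norm u'"
    unfolding l1_norm_def using AE by (intro integral_cong_AE) auto
  then show "l1_norm u = (LINT x|lborel. norm (u' x))" by (simp add: l1_norm_lborel)
qed

section \<open>Fractional derivatives of the heat semigroup\<close>

text \<open>If \<open>K\<close> has transform |\<xi>|^\<beta> exp(-|\<xi>|^2), this is the kernel
  with transform |\<xi>|^\<beta> exp(-s|\<xi>|^2). Its prefactor is the source of t^(-\<beta>/2) in
  the decay rate.\<close>

definition riesz_dilate :: "real \<Rightarrow> (real ^ 'n \<Rightarrow> complex) \<Rightarrow> real \<Rightarrow> real ^ 'n \<Rightarrow> complex" where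
  "riesz_dilate \<beta> K s x = complex_of_real (s powr (- \<beta> / 2)) * dilate s K x"

lemma integrable_riesz_dilate:
  assumes "integrable lborel K" "s > 0"
  shows "integrable lborel (riesz_dilate \<beta> K s)"
  unfolding riesz_dilate_def[abs_def] by (intro integrable_mult_right integrable_dilate assms)

lemma integral_norm_riesz_dilate:
  assumes "integrable lborel K" "s > 0"
  shows "(LINT x|lborel. norm (riesz_dilate \<beta> K s x)) = s powr (- \<beta> / 2) * (LINT x|lborel. norm (K x))"
  using integral_norm_dilate[OF assms] by (simp add: riesz_dilate_def norm_mult)

lemma fourier_transform_riesz_dilate:
  fixes K :: "real ^ 'n \<Rightarrow> complex"
  assumes K: "integrable lborel K" and s: "s > 0"
    and ft: "\<And>\<xi>. fourier_transform K \<xi> = complex_of_real (norm \<xi> powr \<beta> * exp (- (norm \<xi>)\<^sup>2))"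
  shows "fourier_transform (riesz_dilate \<beta> K s) \<xi> = complex_of_real (norm \<xi> powr \<beta> * exp (- s * (norm \<xi>)\<^sup>2))"
proof -
  have d: "integrable lborel (dilate s K)" by (rule integrable_dilate[OF K s])
  have [measurable]: "dilate s K \<in> borel_measurable borel"
    using borel_measurable_integrable[OF d] by simp
  have [measurable]: "riesz_dilate \<beta> K s \<in> borel_measurable borel"
    unfolding riesz_dilate_def[abs_def] by measurable
  have "fourier_transform (riesz_dilate \<beta> K s) \<xi> = complex_of_real (s powr (- \<beta> / 2)) * fourier_transform (dilate s K) \<xi>"
    unfolding fourier_transform_lborel[OF \<open>dilate s K \<in> borel_measurable borel\<close>]
      fourier_transform_lborel[OF \<open>riesz_dilate \<beta> K s \<in> borel_measurable borel\<close>]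
    by (subst integral_mult_right_zero[symmetric]) (simp add: riesz_dilate_def mult_ac)
  also have "\<dots> = complex_of_real (s powr (- \<beta> / 2) * (norm (sqrt s *\<^sub>R \<xi>) powr \<beta> * exp (- (norm (sqrt s *\<^sub>R \<xi>))\<^sup>2)))"
    unfolding fourier_transform_dilate[OF K s] ft by simp
  also have "s powr (- \<beta> / 2) * (norm (sqrt s *\<^sub>R \<xi>) powr \<beta> * exp (- (norm (sqrt s *\<^sub>R \<xi>))\<^sup>2))
      = norm \<xi> powr \<beta> * exp (- s * (norm \<xi>)\<^sup>2)"
  proof -
    have "norm (sqrt s *\<^sub>R \<xi>) powr \<beta> = s powr (\<beta> / 2) * norm \<xi> powr \<beta>"
      using s powr_powr[of s "1/2" \<beta>] by (simp add: powr_mult powr_half_sqrt)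
    moreover have "(norm (sqrt s *\<^sub>R \<xi>))\<^sup>2 = s * (norm \<xi>)\<^sup>2"
      using s by (simp add: power_mult_distrib)
    moreover have "s powr (- \<beta> / 2) * s powr (\<beta> / 2) = 1"
      using s by (simp flip: powr_add)
    ultimately show ?thesis by (simp add: mult.assoc[symmetric])
  qed
  finally show ?thesis .
qed

text \<open>The time is split in halves: the heat kernel factor will take the derivatives, the other
  factor supplies |\<xi>|^\<beta>.\<close>

lemma fourier_transform_convolve_riesz_dilate:
  fixes K :: "real ^ 'n \<Rightarrow> complex"
  assumes K: "integrable lborel K" and t: "t > 0"
    and ft: "\<And>\<xi>. fourier_transform K \<xi> = complex_of_real (norm \<xi> powr \<beta> * exp (- (norm \<xi>)\<^sup>2))"
  shows "fourier_transform (convolve (heat_kernel (t / 2)) (riesz_dilate \<beta> K (t / 2))) \<xi>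
    = complex_of_real (norm \<xi> powr \<beta>) * fourier_transform (heat_kernel t) \<xi>"
proof -
  have t2: "t / 2 > 0" using t by simp
  have "exp (- (t / 2) * (norm \<xi>)\<^sup>2) * exp (- (t / 2) * (norm \<xi>)\<^sup>2) = exp (- t * (norm \<xi>)\<^sup>2)"
    by (simp flip: exp_add)
  then show ?thesis
    unfolding fourier_transform_convolve[OF integrable_heat_kernel[OF t2] integrable_riesz_dilate[OF K t2]]
      fourier_transform_riesz_dilate[OF K t2 ft] fourier_transform_heat_kernel[OF t] fourier_transform_heat_kernel[OF t2]
      of_real_mult[symmetric]
    by (simp only: mult.left_commute)
qed

lemma continuous_convolve_heat_kernel:
  fixes f :: "real ^ 'n \<Rightarrow> complex"
  assumes "integrable lborel f" "t > 0"
  shows "continuous_on UNIV (convolve (heat_kernel t) f)"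
  using continuous_convolve_heat_deriv[OF assms(1), of "\<lambda>_. 0" t] assms(2) by (simp add: heat_deriv_0)

text \<open>Evaluates the definite description: convolution with a heat kernel makes the candidate
  continuous, and Fourier uniqueness excludes any other continuous one.\<close>

lemma frac_deriv_heat_kernel:
  fixes K :: "real ^ 'n \<Rightarrow> complex"
  assumes K: "integrable lborel K" and t: "t > 0"
    and ft: "\<And>\<xi>. fourier_transform K \<xi> = complex_of_real (norm \<xi> powr \<beta> * exp (- (norm \<xi>)\<^sup>2))"
  shows "frac_deriv \<beta> (heat_kernel t) = convolve (heat_kernel (t / 2)) (riesz_dilate \<beta> K (t / 2))"
    (is "_ = ?w")
  unfolding frac_deriv_def
proof (rule the_equality)
  have t2: "t / 2 > 0" using t by simp
  have iw: "integrable lborel ?w"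
    by (intro integrable_convolve integrable_heat_kernel integrable_riesz_dilate K t2)
  have cw: "continuous_on UNIV ?w"
    by (intro continuous_convolve_heat_kernel integrable_riesz_dilate K t2)
  show "continuous_on UNIV ?w \<and> is_frac_deriv \<beta> (heat_kernel t) ?w"
    using cw iw fourier_transform_convolve_riesz_dilate[OF K t ft]
    by (simp add: is_frac_deriv_def integrable_lebesgue_iff_lborel[OF borel_measurable_continuous_onI[OF cw]])
  fix w :: "real ^ 'n \<Rightarrow> complex" assume w: "continuous_on UNIV w \<and> is_frac_deriv \<beta> (heat_kernel t) w"
  then have "integrable lborel w"
    by (auto simp: is_frac_deriv_def integrable_lebesgue_iff_lborel borel_measurable_continuous_onI)
  with w iw cw show "w = ?w"
    using fourier_transform_convolve_riesz_dilate[OF K t ft]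
    by (intro fourier_transform_inject) (auto simp: is_frac_deriv_def)
qed

text \<open>Both sides are continuous and integrable, with transform |\<xi>|^\<beta>
  exp(-t|\<xi>|^2) times that of \<open>v\<close>.\<close>

lemma heat_semigroup_riesz_potential:
  fixes K u v :: "real ^ 'n \<Rightarrow> complex"
  assumes K: "integrable lborel K" and t: "t > 0"
    and ft: "\<And>\<xi>. fourier_transform K \<xi> = complex_of_real (norm \<xi> powr \<beta> * exp (- (norm \<xi>)\<^sup>2))"
    and u: "integrable lborel u" and v: "integrable lborel v"
    and uv: "\<And>\<xi>. fourier_transform u \<xi> = complex_of_real (norm \<xi> powr \<beta>) * fourier_transform v \<xi>"
  shows "convolve (heat_kernel t) u = convolve (heat_kernel (t / 2)) (convolve (riesz_dilate \<beta> K (t / 2)) v)"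
proof (rule fourier_transform_inject)
  have t2: "t / 2 > 0" using t by simp
  have R: "integrable lborel (riesz_dilate \<beta> K (t / 2))" by (rule integrable_riesz_dilate[OF K t2])
  show "integrable lborel (convolve (heat_kernel t) u)"
    "integrable lborel (convolve (heat_kernel (t / 2)) (convolve (riesz_dilate \<beta> K (t / 2)) v))"
    by (intro integrable_convolve integrable_heat_kernel u v R t t2)+
  show "continuous_on UNIV (convolve (heat_kernel t) u)"
    "continuous_on UNIV (convolve (heat_kernel (t / 2)) (convolve (riesz_dilate \<beta> K (t / 2)) v))"
    by (intro continuous_convolve_heat_kernel integrable_convolve u v R t t2)+
  fix \<xi>
  show "fourier_transform (convolve (heat_kernel t) u) \<xi> =
      fourier_transform (convolve (heat_kernel (t / 2)) (convolve (riesz_dilate \<beta> K (t / 2)) v)) \<xi>"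
    using fourier_transform_convolve_riesz_dilate[OF K t ft, of \<xi>]
    by (simp add: fourier_transform_convolve integrable_convolve integrable_heat_kernel u v R t t2 uv mult_ac)
qed

text \<open>The hypothesis says nothing at \<xi> = 0; there the identity follows by continuity of
  both sides, as \<beta> > 0. In particular \<open>u\<close> has integral zero.\<close>

lemma fourier_transform_eq_of_riesz_potential:
  fixes u v :: "real ^ 'n \<Rightarrow> complex"
  assumes \<beta>: "\<beta> > 0" and u: "integrable lborel u" and v: "integrable lborel v"
    and uv: "\<And>\<xi>. \<xi> \<noteq> 0 \<Longrightarrow> fourier_transform v \<xi> = fourier_transform u \<xi> / complex_of_real (norm \<xi> powr \<beta>)"
  shows "fourier_transform u \<xi> = complex_of_real (norm \<xi> powr \<beta>) * fourier_transform v \<xi>"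
proof (cases "\<xi> = 0")
  case True
  have "((\<lambda>\<xi>. complex_of_real (norm \<xi> powr \<beta>) * fourier_transform v \<xi>)
      \<longlongrightarrow> complex_of_real (norm (0 :: real ^ 'n) powr \<beta>) * fourier_transform v 0) (at 0)"
    using isCont_fourier_transform[OF v, of 0] \<beta>
    by (intro tendsto_intros) (auto simp: isCont_def)
  moreover have "\<forall>\<^sub>F \<xi> in at 0. fourier_transform u \<xi> = complex_of_real (norm \<xi> powr \<beta>) * fourier_transform v \<xi>"
    using uv by (simp add: eventually_at_filter)
  ultimately have "(fourier_transform u \<longlongrightarrow> complex_of_real (norm (0 :: real ^ 'n) powr \<beta>) * fourier_transform v 0) (at 0)"
    by (simp add: tendsto_cong)
  moreover have "(fourier_transform u \<longlongrightarrow> fourier_transform u 0) (at 0)"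
    using isCont_fourier_transform[OF u, of 0] by (simp add: isCont_def)
  ultimately show ?thesis
    using True tendsto_unique[OF at_neq_bot] by blast
qed (use uv in simp)

section \<open>The decay estimate and the large-time asymptotics\<close>

theorem proposition2p1:
  fixes \<beta> :: real and \<gamma> :: "nat ^ 'n::{finite,linorder}"
  assumes "\<beta> > 0"
  shows "\<exists>C :: real. \<forall>(u\<^sub>0 :: real ^ 'n::{finite,linorder} \<Rightarrow> complex)
     (v :: real ^ 'n::{finite,linorder} \<Rightarrow> complex) (A :: complex).
    integrable lebesgue u\<^sub>0 \<longrightarrow> is_riesz_potential \<beta> u\<^sub>0 v \<longrightarrow> A = (LINT x|lebesgue. v x) \<longrightarrow>
      ((\<lambda>\<xi>. fourier_transform u\<^sub>0 \<xi> / complex_of_real (norm \<xi> powr \<beta>)) \<longlongrightarrow> A) (at 0) \<and>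
      (\<forall>t>0. integrable lebesgue (multi_deriv \<gamma> (heat_semigroup t u\<^sub>0)) \<and>
         l1_norm (multi_deriv \<gamma> (heat_semigroup t u\<^sub>0))
           \<le> C * t powr (- \<beta> / 2 - real (multi_order \<gamma>) / 2) * l1_norm v) \<and>
      (\<forall>t>0. integrable lebesgue (\<lambda>x. multi_deriv \<gamma> (heat_semigroup t u\<^sub>0) x
                 - A * multi_deriv \<gamma> (frac_deriv \<beta> (heat_kernel t)) x)) \<and>
      ((\<lambda>t. t powr (\<beta> / 2 + real (multi_order \<gamma>) / 2) *
            l1_norm (\<lambda>x. multi_deriv \<gamma> (heat_semigroup t u\<^sub>0) x
                 - A * multi_deriv \<gamma> (frac_deriv \<beta> (heat_kernel t)) x)) \<longlongrightarrow> 0) at_top"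
proof -
  \<comment> \<open>Time 1/2, because a heat kernel at time 1/2 is convolved on next and the total
    time should be 1.\<close>
  obtain k :: "real ^ 'n::{finite,linorder} \<Rightarrow> complex" where k: "integrable lborel k"
    "\<And>\<xi>. fourier_transform k \<xi> = complex_of_real (norm \<xi> powr \<beta> * exp (- (1 / 2) * (norm \<xi>)\<^sup>2))"
    using riesz_heat_kernel_exists[OF assms, of "1 / 2"] by auto
  \<comment> \<open>the extra Gaussian factor makes translation continuity in \<open>L\<^sup>1\<close> elementary\<close>
  define K where "K = convolve (heat_kernel (1 / 2)) k"
  have K: "integrable lborel K"
    unfolding K_def by (intro integrable_convolve integrable_heat_kernel k) simp
  have ft: "fourier_transform K \<xi> = complex_of_real (norm \<xi> powr \<beta> * exp (- (norm \<xi>)\<^sup>2))" for \<xi>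
  proof -
    have "exp (- (1 / 2) * (norm \<xi>)\<^sup>2) * exp (- (1 / 2) * (norm \<xi>)\<^sup>2) = exp (- (norm \<xi>)\<^sup>2)"
      by (simp flip: exp_add)
    moreover have "fourier_transform K \<xi> = complex_of_real (exp (- (1 / 2) * (norm \<xi>)\<^sup>2)) *
        complex_of_real (norm \<xi> powr \<beta> * exp (- (1 / 2) * (norm \<xi>)\<^sup>2))"
      unfolding K_def k(2)[symmetric]
      using fourier_transform_convolve[OF integrable_heat_kernel[of "1 / 2"] k(1), of \<xi>]
        fourier_transform_heat_kernel[of "1 / 2" \<xi>] by simp
    ultimately show ?thesis
      unfolding of_real_mult[symmetric] by (simp only: mult.left_commute)
  qed
  have tr: "isCont (\<lambda>h. LINT x|lborel. norm (K (x - h) - K x)) 0"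
    unfolding K_def by (rule isCont_convolve_heat_kernel_translate[OF _ k(1)]) simp
  define H where "H t = (heat_deriv (($) \<gamma>) t :: real ^ 'n::{finite,linorder} \<Rightarrow> complex)" for t
  define m where "m = real (multi_order \<gamma>)"
  define N where "N = (LINT x|lborel. norm (H 1 x))"
  define L where "L = (LINT x|lborel. norm (K x))"
  let ?R = "riesz_dilate \<beta> K"
  have H: "integrable lborel (H t)" and HN: "(LINT x|lborel. norm (H t x)) = t powr (- m / 2) * N" if "t > 0" for t
    using that integrable_heat_deriv[OF that] integral_norm_heat_deriv[OF that]
    by (auto simp: H_def N_def m_def multi_order_def)
  have R: "integrable lborel (?R t)" and RN: "(LINT x|lborel. norm (?R t x)) = t powr (- \<beta> / 2) * L" if "t > 0" for t
    using integrable_riesz_dilate[OF K that] integral_norm_riesz_dilate[OF K that] by (auto simp: L_def)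
  \<comment> \<open>Both factors live at time t/2; the resulting power of 2 goes into the
    constant.\<close>
  have powr: "(t / 2) powr (- m / 2) * (t / 2) powr (- \<beta> / 2) = 2 powr (\<beta> / 2 + m / 2) * t powr (- \<beta> / 2 - m / 2)" if "t > 0" for t
  proof -
    have "(t / 2) powr (- m / 2) * (t / 2) powr (- \<beta> / 2) = (t / 2) powr (- \<beta> / 2 - m / 2)"
      unfolding powr_add[symmetric] by (rule arg_cong[of _ _ "\<lambda>a. (t / 2) powr a"]) simp
    also have "\<dots> = t powr (- \<beta> / 2 - m / 2) / 2 powr (- (\<beta> / 2 + m / 2))"
      using that by (simp add: powr_divide)
    also have "\<dots> = 2 powr (\<beta> / 2 + m / 2) * t powr (- \<beta> / 2 - m / 2)"
      by (simp only: powr_minus divide_inverse inverse_inverse_eq mult.commute)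
    finally show ?thesis .
  qed
  have D: "multi_deriv \<gamma> (frac_deriv \<beta> (heat_kernel t)) = convolve (H (t / 2)) (?R (t / 2))" if "t > 0" for t
    unfolding frac_deriv_heat_kernel[OF K that ft] H_def
    using that by (intro multi_deriv_convolve_heat_kernel R) auto
  show ?thesis
  \<comment> \<open>The norms of the differentiated heat kernel and of \<open>K\<close> at time 1,
    times the cost of halving the time; all fixed before the data are chosen.\<close>
  proof (intro exI[of _ "N * L * 2 powr (\<beta> / 2 + m / 2)"] allI impI)
    fix u\<^sub>0 v :: "real ^ 'n::{finite,linorder} \<Rightarrow> complex" and A :: complex
    assume u0: "integrable lebesgue u\<^sub>0" and v0: "is_riesz_potential \<beta> u\<^sub>0 v" and A: "A = (LINT x|lebesgue. v x)"
    have iv: "integrable lebesgue v" using v0 by (simp add: is_riesz_potential_def)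
    obtain u where u: "integrable lborel u" "AE x in lebesgue. u\<^sub>0 x = u x"
      by (rule lebesgue_integrable_borel_representative[OF u0])
    obtain w where w: "integrable lborel w" "AE x in lebesgue. v x = w x"
      by (rule lebesgue_integrable_borel_representative[OF iv])
    have wm [measurable]: "w \<in> borel_measurable borel" using borel_measurable_integrable[OF w(1)] by simp
    have uw: "fourier_transform w \<xi> = fourier_transform u \<xi> / complex_of_real (norm \<xi> powr \<beta>)" if "\<xi> \<noteq> 0" for \<xi>
      using v0 that fourier_transform_cong_lborel[OF u0 u] fourier_transform_cong_lborel[OF iv w]
      by (simp add: is_riesz_potential_def)
    have uw': "fourier_transform u \<xi> = complex_of_real (norm \<xi> powr \<beta>) * fourier_transform w \<xi>" for \<xi>
      by (rule fourier_transform_eq_of_riesz_potential[OF assms u(1) w(1)]) (rule uw)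
    have Aw: "A = (LINT x|lborel. w x)" unfolding A by (rule integral_cong_lborel[OF iv w])
    \<comment> \<open>So the limit defining A is continuity at 0 of the transform of the Riesz
      potential.\<close>
    have "fourier_transform w 0 = A"
      by (simp add: Aw fourier_transform_lborel)
    then have "(fourier_transform w \<longlongrightarrow> A) (at 0)"
      using isCont_fourier_transform[OF w(1), of 0] by (simp add: isCont_def)
    moreover have "\<forall>\<^sub>F \<xi> in at 0. fourier_transform w \<xi> = fourier_transform u\<^sub>0 \<xi> / complex_of_real (norm \<xi> powr \<beta>)"
      using uw fourier_transform_cong_lborel[OF u0 u] by (simp add: eventually_at_filter)
    ultimately have lim: "((\<lambda>\<xi>. fourier_transform u\<^sub>0 \<xi> / complex_of_real (norm \<xi> powr \<beta>)) \<longlongrightarrow> A) (at 0)"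
      by (rule Lim_transform_eventually)
    have RW: "integrable lborel (convolve (?R t) w)" if "t > 0" for t
      by (intro integrable_convolve R that w)
    have S: "multi_deriv \<gamma> (heat_semigroup t u\<^sub>0) = convolve (H (t / 2)) (convolve (?R (t / 2)) w)" if t: "t > 0" for t
      unfolding heat_semigroup_eq_convolve[OF u0 u] heat_semigroup_riesz_potential[OF K t ft u(1) w(1) uw'] H_def
      using t by (intro multi_deriv_convolve_heat_kernel RW) auto
    have bound: "integrable lebesgue (multi_deriv \<gamma> (heat_semigroup t u\<^sub>0)) \<and>
         l1_norm (multi_deriv \<gamma> (heat_semigroup t u\<^sub>0))
           \<le> N * L * 2 powr (\<beta> / 2 + m / 2) * t powr (- \<beta> / 2 - m / 2) * l1_norm v" if t: "t > 0" for t
    proof -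
      have t2: "t / 2 > 0" using t by simp
      let ?f = "convolve (H (t / 2)) (convolve (?R (t / 2)) w)"
      have i: "integrable lborel ?f" by (intro integrable_convolve H RW t2)
      then have [measurable]: "?f \<in> borel_measurable borel" using borel_measurable_integrable by fastforce
      have "(LINT x|lborel. norm (?f x))
          \<le> (LINT x|lborel. norm (H (t / 2) x)) * (LINT x|lborel. norm (convolve (?R (t / 2)) w x))"
        by (intro norm_convolve_le H RW t2)
      also have "\<dots> \<le> (LINT x|lborel. norm (H (t / 2) x)) * ((LINT x|lborel. norm (?R (t / 2) x)) * (LINT x|lborel. norm (w x)))"
        by (intro mult_left_mono norm_convolve_le R t2 w) simp
      also have "\<dots> = N * L * ((t / 2) powr (- m / 2) * (t / 2) powr (- \<beta> / 2)) * l1_norm v"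
        by (simp add: HN[OF t2] RN[OF t2] l1_norm_cong_lborel[OF iv w] mult_ac)
      also have "\<dots> = N * L * 2 powr (\<beta> / 2 + m / 2) * t powr (- \<beta> / 2 - m / 2) * l1_norm v"
        unfolding powr[OF t] by (simp only: mult.assoc)
      finally show ?thesis
        using i by (simp add: S[OF t] l1_norm_lborel integrable_lebesgue_iff_lborel)
    qed
    \<comment> \<open>The error before convolution with the differentiated heat kernel; by linearity
      the full error is that convolution.\<close>
    define E where "E t x = convolve (?R t) w x - A * ?R t x" for t x
    have E: "integrable lborel (E t)" if "t > 0" for t
      unfolding E_def[abs_def]
      by (intro Bochner_Integration.integrable_diff integrable_mult_right RW R that)
    have diff: "(\<lambda>x. multi_deriv \<gamma> (heat_semigroup t u\<^sub>0) x - A * multi_deriv \<gamma> (frac_deriv \<beta> (heat_kernel t)) x)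
        = convolve (H (t / 2)) (E (t / 2))" if t: "t > 0" for t
    proof
      fix x
      have t2: "t / 2 > 0" using t by simp
      have i: "integrable lborel (\<lambda>y. H (t / 2) (x - y) * f y)" if "integrable lborel f" for f
        unfolding H_def by (rule integrable_convolve_integrand[OF that])
      have "convolve (H (t / 2)) (E (t / 2)) x = (LINT y|lborel. H (t / 2) (x - y) * convolve (?R (t / 2)) w y
          - A * (H (t / 2) (x - y) * ?R (t / 2) y))"
        unfolding convolve_def[of "H (t / 2)"] E_def by (simp add: algebra_simps)
      also have "\<dots> = convolve (H (t / 2)) (convolve (?R (t / 2)) w) x - A * convolve (H (t / 2)) (?R (t / 2)) x"
        using i[OF RW[OF t2]] i[OF R[OF t2]] by (simp add: convolve_def[of "H (t / 2)"])
      finally show "multi_deriv \<gamma> (heat_semigroup t u\<^sub>0) x - A * multi_deriv \<gamma> (frac_deriv \<beta> (heat_kernel t)) x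
          = convolve (H (t / 2)) (E (t / 2)) x"
        by (simp add: S[OF t] D[OF t])
    qed
    have HE: "integrable lborel (convolve (H (t / 2)) (E (t / 2)))" if "t > 0" for t
      using that by (intro integrable_convolve H E) auto
    then have HEm: "convolve (H (t / 2)) (E (t / 2)) \<in> borel_measurable borel" if "t > 0" for t
      using that borel_measurable_integrable by fastforce
    have int: "integrable lebesgue (\<lambda>x. multi_deriv \<gamma> (heat_semigroup t u\<^sub>0) x
        - A * multi_deriv \<gamma> (frac_deriv \<beta> (heat_kernel t)) x)" if t: "t > 0" for t
      unfolding diff[OF t] using HE[OF t] HEm[OF t] by (simp add: integrable_lebesgue_iff_lborel)
    \<comment> \<open>The norm of \<open>E s\<close> without its factor s^(-\<beta>/2).\<close>
    define e where "e s = (LINT x|lborel. norm (convolve (dilate s K) w x - A * dilate s K x))" for s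
    have e0: "(e \<longlongrightarrow> 0) at_top"
      unfolding e_def Aw by (rule convolve_dilate_tendsto[OF K w(1) tr])
    have EN: "(LINT x|lborel. norm (E s x)) = s powr (- \<beta> / 2) * e s" for s
    proof -
      have "convolve (?R s) w x = complex_of_real (s powr (- \<beta> / 2)) * convolve (dilate s K) w x" for x
        unfolding convolve_def riesz_dilate_def
        by (subst integral_mult_right_zero[symmetric]) (simp only: mult.assoc)
      then have "E s x = complex_of_real (s powr (- \<beta> / 2)) * (convolve (dilate s K) w x - A * dilate s K x)" for x
        by (simp add: E_def riesz_dilate_def algebra_simps)
      then show ?thesis by (simp add: norm_mult e_def)
    qed
    \<comment> \<open>Young's inequality gives exactly the power of t that the weight cancels,
      leaving a constant times \<open>e (t / 2)\<close>.\<close>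
    have le: "t powr (\<beta> / 2 + m / 2) * l1_norm (\<lambda>x. multi_deriv \<gamma> (heat_semigroup t u\<^sub>0) x
        - A * multi_deriv \<gamma> (frac_deriv \<beta> (heat_kernel t)) x) \<le> N * 2 powr (\<beta> / 2 + m / 2) * e (t / 2)" if t: "t > 0" for t
    proof -
      have t2: "t / 2 > 0" using t by simp
      have "l1_norm (convolve (H (t / 2)) (E (t / 2))) \<le> (LINT x|lborel. norm (H (t / 2) x)) * (LINT x|lborel. norm (E (t / 2) x))"
        unfolding l1_norm_lborel[OF HEm[OF t]] by (intro norm_convolve_le H E t2)
      also have "\<dots> = ((t / 2) powr (- m / 2) * (t / 2) powr (- \<beta> / 2)) * (N * e (t / 2))"
        by (simp add: HN[OF t2] EN mult_ac)
      finally have "t powr (\<beta> / 2 + m / 2) * l1_norm (convolve (H (t / 2)) (E (t / 2)))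
          \<le> t powr (\<beta> / 2 + m / 2) * (2 powr (\<beta> / 2 + m / 2) * t powr (- \<beta> / 2 - m / 2) * (N * e (t / 2)))"
        unfolding powr[OF t] by (rule mult_left_mono) simp
      also have "\<dots> = (t powr (\<beta> / 2 + m / 2) * t powr (- \<beta> / 2 - m / 2)) * (N * 2 powr (\<beta> / 2 + m / 2) * e (t / 2))"
        by (simp only: mult_ac)
      also have "t powr (\<beta> / 2 + m / 2) * t powr (- \<beta> / 2 - m / 2) = 1"
        using t by (simp flip: powr_add)
      finally show ?thesis unfolding diff[OF t] by simp
    qed
    have "filterlim (\<lambda>t::real. t / 2) at_top at_top"
      by real_asymp
    from filterlim_compose[OF e0 this]
    have up: "((\<lambda>t. N * 2 powr (\<beta> / 2 + m / 2) * e (t / 2)) \<longlongrightarrow> 0) at_top"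
      by (rule tendsto_mult_right_zero)
    have "((\<lambda>t. t powr (\<beta> / 2 + m / 2) * l1_norm (\<lambda>x. multi_deriv \<gamma> (heat_semigroup t u\<^sub>0) x
        - A * multi_deriv \<gamma> (frac_deriv \<beta> (heat_kernel t)) x)) \<longlongrightarrow> 0) at_top"
    proof (rule tendsto_sandwich[OF _ _ tendsto_const up])
      show "\<forall>\<^sub>F t in at_top. 0 \<le> t powr (\<beta> / 2 + m / 2) * l1_norm (\<lambda>x. multi_deriv \<gamma> (heat_semigroup t u\<^sub>0) x
        - A * multi_deriv \<gamma> (frac_deriv \<beta> (heat_kernel t)) x)"
        by (intro always_eventually allI) (simp add: l1_norm_def)
      show "\<forall>\<^sub>F t in at_top. t powr (\<beta> / 2 + m / 2) * l1_norm (\<lambda>x. multi_deriv \<gamma> (heat_semigroup t u\<^sub>0) x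
        - A * multi_deriv \<gamma> (frac_deriv \<beta> (heat_kernel t)) x) \<le> N * 2 powr (\<beta> / 2 + m / 2) * e (t / 2)"
        using eventually_gt_at_top[of 0] by eventually_elim (rule le)
    qed
    with lim bound int show "((\<lambda>\<xi>. fourier_transform u\<^sub>0 \<xi> / complex_of_real (norm \<xi> powr \<beta>)) \<longlongrightarrow> A) (at 0) \<and>
      (\<forall>t>0. integrable lebesgue (multi_deriv \<gamma> (heat_semigroup t u\<^sub>0)) \<and>
         l1_norm (multi_deriv \<gamma> (heat_semigroup t u\<^sub>0))
           \<le> N * L * 2 powr (\<beta> / 2 + m / 2) * t powr (- \<beta> / 2 - real (multi_order \<gamma>) / 2) * l1_norm v) \<and>
      (\<forall>t>0. integrable lebesgue (\<lambda>x. multi_deriv \<gamma> (heat_semigroup t u\<^sub>0) x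
                 - A * multi_deriv \<gamma> (frac_deriv \<beta> (heat_kernel t)) x)) \<and>
      ((\<lambda>t. t powr (\<beta> / 2 + real (multi_order \<gamma>) / 2) *
            l1_norm (\<lambda>x. multi_deriv \<gamma> (heat_semigroup t u\<^sub>0) x
                 - A * multi_deriv \<gamma> (frac_deriv \<beta> (heat_kernel t)) x)) \<longlongrightarrow> 0) at_top"
      unfolding m_def by blast
  qed
qed

end
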